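(* Let $\mathfrak g$ be a finite-dimensional non-commutative complex reductive Lie algebra. Let $\mathfrak j_0$ be a Cartan subalgebra of $\mathfrak g$, $\mathfrak b_0$ a Borel subalgebra of $\mathfrak g$ containing $\mathfrak j_0$, $\mathfrak b'_0$ the Borel subalgebra opposite to $\mathfrak b_0$ with respect to $\mathfrak j_0$, and let $\mathfrak p,\mathfrak p'$ be parabolic subalgebras of $\mathfrak g$ with $\mathfrak b_0\subset\mathfrak p$ and $\mathfrak b'_0\subset\mathfrak p'$. If there exists a Manin triple $(B,\mathfrak i,\mathfrak i')$ in $\mathfrak g$ under $(\mathfrak p,\mathfrak p')$, then $\mathfrak p\neq\mathfrak g$ or $\mathfrak p'\neq\mathfrak g$.
   Context: A Manin form on a complex reductive Lie algebra $\mathfrak g$ is a symmetric, $\mathfrak g$-invariant, $\mathbb R$-bilinear form $B:\mathfrak g\times\mathfrak g\to\mathbb R$ of signature $(\dim_{\mathbb C}\mathfrak g,\dim_{\mathbb C}\mathfrak g)$. A Manin triple in $\mathfrak g$ is a triple $(B,\mathfrak i,\mathfrak i')$ where $B$ is a Manin form and $\mathfrak i,\mathfrak i'$ are real Lie subalgebras of $\mathfrak g$, isotropic for $B$, with $\mathfrak g=\mathfrak i\oplus\mathfrak i'$ (each then has real dimension $\dim_{\mathbb C}\mathfrak g$). A real Lie subalgebra $\mathfrak i$, isotropic for $B$ and of real dimension $\dim_{\mathbb C}\mathfrak g$, is said to be under $\mathfrak p$ if $\mathfrak p$ is the normalizer in $\mathfrak g$ of the nilpotent radical of $\mathfrak i$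 (this normalizer is a parabolic subalgebra of $\mathfrak g$). The nilpotent radical of a Lie algebra is the largest ideal all of whose elements act nilpotently in every finite-dimensional representation. A Manin triple $(B,\mathfrak i,\mathfrak i')$ is under $(\mathfrak p,\mathfrak p')$ if $\mathfrak i$ is under $\mathfrak p$ and $\mathfrak i'$ is under $\mathfrak p'$. *)

theory Defs
  imports Complex_Main "Jordan_Normal_Form.Matrix"
begin

definition direct_sum_decomposition :: "'g::ab_group_add set \<Rightarrow> 'g set \<Rightarrow> bool" where
  "direct_sum_decomposition U V \<longleftrightarrow> U \<inter> V = {0} \<and> (\<forall>x. \<exists>u\<in>U. \<exists>v\<in>V. x = u + v)"

locale lie_algebra = Vector_Spaces.vector_space scale
  for scale :: "'k::field \<Rightarrow> 'g::ab_group_add \<Rightarrow> 'g" +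
  fixes bracket :: "'g \<Rightarrow> 'g \<Rightarrow> 'g"
  assumes bracket_add_left: "bracket (x + y) z = bracket x z + bracket y z"
    and bracket_add_right: "bracket x (y + z) = bracket x y + bracket x z"
    and bracket_scale_left: "bracket (scale c x) y = scale c (bracket x y)"
    and bracket_scale_right: "bracket x (scale c y) = scale c (bracket x y)"
    and bracket_self: "bracket x x = 0"
    and jacobi: "bracket x (bracket y z) + bracket y (bracket z x) + bracket z (bracket x y) = 0"
begin

definition subalgebra :: "'g set \<Rightarrow> bool" where
  "subalgebra h \<longleftrightarrow> subspace h \<and> (\<forall>x\<in>h. \<forall>y\<in>h. bracket x y \<in> h)"

definition ideal_of :: "'g set \<Rightarrow> 'g set \<Rightarrow> bool" where
  "ideal_of n h \<longleftrightarrow> subspace n \<and> n \<subseteq> h \<and> (\<forall>x\<in>h. \<forall>y\<in>n. bracket x y \<in> n)"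

definition normalizer :: "'g set \<Rightarrow> 'g set" where
  "normalizer n = {x. \<forall>y\<in>n. bracket x y \<in> n}"

definition commutator :: "'g set \<Rightarrow> 'g set \<Rightarrow> 'g set" where
  "commutator a b = span {bracket x y | x y. x \<in> a \<and> y \<in> b}"

definition solvable :: "'g set \<Rightarrow> bool" where
  "solvable h \<longleftrightarrow> (\<exists>k. ((\<lambda>a. commutator a a) ^^ k) h = {0})"

definition nilpotent :: "'g set \<Rightarrow> bool" where
  "nilpotent h \<longleftrightarrow> (\<exists>k. (commutator h ^^ k) h = {0})"

text \<open>The adjoint representation is completely reducible.\<close>

definition reductive :: bool where
  "reductive \<longleftrightarrow> (\<forall>a. ideal_of a UNIV \<longrightarrow>
     (\<exists>b. ideal_of b UNIV \<and> direct_sum_decomposition a b))"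

definition commutative :: bool where
  "commutative \<longleftrightarrow> (\<forall>x y. bracket x y = 0)"

definition cartan_subalgebra :: "'g set \<Rightarrow> bool" where
  "cartan_subalgebra j \<longleftrightarrow> subalgebra j \<and> nilpotent j \<and> normalizer j = j"

definition borel_subalgebra :: "'g set \<Rightarrow> bool" where
  "borel_subalgebra b \<longleftrightarrow> subalgebra b \<and> solvable b \<and>
     (\<forall>c. subalgebra c \<and> solvable c \<and> b \<subseteq> c \<longrightarrow> c = b)"

definition parabolic_subalgebra :: "'g set \<Rightarrow> bool" where
  "parabolic_subalgebra p \<longleftrightarrow> subalgebra p \<and> (\<exists>b. borel_subalgebra b \<and> b \<subseteq> p)"

text \<open>
  Only the values of \<open>\<alpha>\<close> on \<open>j\<close> matter. When the root space is nonzero, they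
  automatically form a linear functional on \<open>j\<close>. Genuine (rather than generalized) eigenspaces
  suffice because a Cartan subalgebra of a complex reductive Lie algebra acts diagonalizably.
\<close>

definition root_space :: "'g set \<Rightarrow> ('g \<Rightarrow> 'k) \<Rightarrow> 'g set" where
  "root_space j \<alpha> = {x. \<forall>h\<in>j. bracket h x = scale (\<alpha> h) x}"

definition is_root :: "'g set \<Rightarrow> ('g \<Rightarrow> 'k) \<Rightarrow> bool" where
  "is_root j \<alpha> \<longleftrightarrow> (\<exists>h\<in>j. \<alpha> h \<noteq> 0) \<and> root_space j \<alpha> \<noteq> {0}"

definition opposite_borel :: "'g set \<Rightarrow> 'g set \<Rightarrow> 'g set" where
  "opposite_borel j b =
     span (j \<union> \<Union>{root_space j (\<lambda>h. - \<alpha> h) | \<alpha>. is_root j \<alpha> \<and> root_space j \<alpha> \<subseteq> b})"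

text \<open>
  Finite-dimensional representations of \<open>h\<close> over the ground field, in coordinates;
  the values of \<open>\<rho>\<close> outside \<open>h\<close> are irrelevant.
\<close>

definition lie_representation :: "'g set \<Rightarrow> nat \<Rightarrow> ('g \<Rightarrow> 'k mat) \<Rightarrow> bool" where
  "lie_representation h d \<rho> \<longleftrightarrow>
     (\<forall>x\<in>h. \<rho> x \<in> carrier_mat d d) \<and>
     (\<forall>x\<in>h. \<forall>y\<in>h. \<rho> (x + y) = \<rho> x + \<rho> y) \<and>
     (\<forall>c. \<forall>x\<in>h. \<rho> (scale c x) = c \<cdot>\<^sub>m \<rho> x) \<and>
     (\<forall>x\<in>h. \<forall>y\<in>h. \<rho> (bracket x y) = \<rho> x * \<rho> y - \<rho> y * \<rho> x)"

definition acts_nilpotently :: "'g set \<Rightarrow> 'g \<Rightarrow> bool" where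
  "acts_nilpotently h x \<longleftrightarrow>
     (\<forall>d \<rho>. lie_representation h d \<rho> \<longrightarrow> (\<exists>k. \<rho> x ^\<^sub>m k = 0\<^sub>m d d))"

definition nilpotent_ideal_of :: "'g set \<Rightarrow> 'g set \<Rightarrow> bool" where
  "nilpotent_ideal_of n h \<longleftrightarrow> ideal_of n h \<and> (\<forall>x\<in>n. acts_nilpotently h x)"

definition is_nilpotent_radical :: "'g set \<Rightarrow> 'g set \<Rightarrow> bool" where
  "is_nilpotent_radical n h \<longleftrightarrow>
     nilpotent_ideal_of n h \<and> (\<forall>m. nilpotent_ideal_of m h \<longrightarrow> m \<subseteq> n)"

lemma is_nilpotent_radical_unique:
  "is_nilpotent_radical n h \<Longrightarrow> is_nilpotent_radical m h \<Longrightarrow> n = m"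
  by (auto simp: is_nilpotent_radical_def)

end

locale complex_lie_algebra = lie_algebra scale bracket
  for scale :: "complex \<Rightarrow> 'g::ab_group_add \<Rightarrow> 'g" and bracket :: "'g \<Rightarrow> 'g \<Rightarrow> 'g" +
  assumes finite_dim: "\<exists>E. finite E \<and> span E = UNIV"
begin

sublocale real: lie_algebra "\<lambda>r. scale (complex_of_real r)" bracket
  by unfold_locales
    (simp_all add: scale_right_distrib scale_left_distrib bracket_add_left bracket_add_right
      bracket_scale_left bracket_scale_right bracket_self jacobi)

definition symmetric_bilinear :: "('g \<Rightarrow> 'g \<Rightarrow> real) \<Rightarrow> bool" where
  "symmetric_bilinear B \<longleftrightarrow>
     (\<forall>x y. B x y = B y x) \<and>
     (\<forall>x. Vector_Spaces.linear (\<lambda>r. scale (complex_of_real r)) (*) (B x))"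

definition invariant :: "('g \<Rightarrow> 'g \<Rightarrow> real) \<Rightarrow> bool" where
  "invariant B \<longleftrightarrow> (\<forall>x y z. B (bracket x y) z + B y (bracket x z) = 0)"

definition has_signature :: "('g \<Rightarrow> 'g \<Rightarrow> real) \<Rightarrow> nat \<Rightarrow> nat \<Rightarrow> bool" where
  "has_signature B p q \<longleftrightarrow>
     (\<exists>E. finite E \<and> real.independent E \<and> real.span E = UNIV \<and>
          (\<forall>e\<in>E. \<forall>f\<in>E. e \<noteq> f \<longrightarrow> B e f = 0) \<and>
          card {e\<in>E. B e e > 0} = p \<and> card {e\<in>E. B e e < 0} = q)"

definition manin_form :: "('g \<Rightarrow> 'g \<Rightarrow> real) \<Rightarrow> bool" where
  "manin_form B \<longleftrightarrow>
     symmetric_bilinear B \<and> invariant B \<and> has_signature B (dim UNIV) (dim UNIV)"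

definition isotropic :: "('g \<Rightarrow> 'g \<Rightarrow> real) \<Rightarrow> 'g set \<Rightarrow> bool" where
  "isotropic B i \<longleftrightarrow> (\<forall>x\<in>i. \<forall>y\<in>i. B x y = 0)"

definition manin_triple :: "('g \<Rightarrow> 'g \<Rightarrow> real) \<Rightarrow> 'g set \<Rightarrow> 'g set \<Rightarrow> bool" where
  "manin_triple B i i' \<longleftrightarrow>
     manin_form B \<and> real.subalgebra i \<and> real.subalgebra i' \<and>
     isotropic B i \<and> isotropic B i' \<and> direct_sum_decomposition i i'"

definition under :: "('g \<Rightarrow> 'g \<Rightarrow> real) \<Rightarrow> 'g set \<Rightarrow> 'g set \<Rightarrow> bool" where
  "under B i p \<longleftrightarrow>
     real.subalgebra i \<and> isotropic B i \<and> real.dim i = dim UNIV \<and>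
     (\<exists>n. real.is_nilpotent_radical n i \<and> p = normalizer n)"

definition manin_triple_under ::
    "('g \<Rightarrow> 'g \<Rightarrow> real) \<Rightarrow> 'g set \<Rightarrow> 'g set \<Rightarrow> 'g set \<Rightarrow> 'g set \<Rightarrow> bool" where
  "manin_triple_under B i i' p p' \<longleftrightarrow> manin_triple B i i' \<and> under B i p \<and> under B i' p'"

end

end

theory Submission
  imports Defs "Jordan_Normal_Form.Jordan_Normal_Form_Existence" "HOL-Library.Function_Algebras"
begin

text \<open>
Suppose that both normalizers are \<open>g\<close>. The nilpotent radicals \<open>n\<close> and \<open>n'\<close> of \<open>i\<close> and \<open>i'\<close> are then
real ideals of \<open>g\<close>. Their elements are \<open>ad\<close>-nilpotent, because \<open>ad\<close> restricts to representations
of \<open>i\<close> and \<open>i'\<close> on \<open>g\<close>; so \<open>n\<close> and \<open>n'\<close> are solvable by Engel's theorem, and central because \<open>g\<close> is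
reductive (\<open>radical_central\<close>). The contradiction comes from traces, and everything is done over the reals, where
\<open>B\<close> lives.

Since the nilpotent radical of \<open>i\<close> is central, \<open>i\<close> is close to reductive: for every solvable ideal \<open>r\<close>
of \<open>i\<close> the ideal \<open>[i, r]\<close> acts nilpotently in all representations and so lies in \<open>n\<close>
(\<open>commutator_solvable_subset_radical\<close>). With Cartan's criterion this makes \<open>i\<close> unimodular, that is,
\<open>tr ad x = 0\<close> on \<open>i\<close> for every \<open>x\<close> in \<open>i\<close> (\<open>adjoint_trace_zero\<close>), and likewise for \<open>i'\<close>.

Take families \<open>a\<^sub>e\<close> in \<open>i\<close> and \<open>b\<^sub>e\<close> in \<open>i'\<close> that are dual for \<open>B\<close>. The vector \<open>u = \<Sum> [a\<^sub>e, b\<^sub>e]\<close> represents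
the linear form \<open>x \<mapsto> tr (ad x \<circ> P)\<close>, where \<open>P\<close> is the projection onto \<open>i\<close> along \<open>i'\<close>; so \<open>u = 0\<close> if both
subalgebras are unimodular (\<open>sum_brackets_zero\<close>). On the other hand, for every \<open>B\<close>-symmetric operator
\<open>J\<close> that commutes with \<open>ad\<close> there is a relative of the strange formula of Freudenthal and de Vries,
\<open>\<Sum> K(J a\<^sub>e, b\<^sub>e) = 3 B(u, J u)\<close> with \<open>K\<close> the Killing form (\<open>strange_formula\<close>). Let \<open>D\<close> be the operator
with \<open>B(D x, y) = K(x, y)\<close>. For \<open>J = D\<^sup>k\<close> the left-hand side is half the trace of \<open>D\<^sup>k\<^sup>+\<^sup>1\<close>. Hence all
powers of \<open>D\<close> have trace zero, and \<open>D\<close> is nilpotent (\<open>D_nilpotent\<close>).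

In a reductive Lie algebra this is only possible if it is commutative: the radical of \<open>K\<close> is solvable
by Cartan's criterion, hence central, so that \<open>x\<close> is central whenever \<open>D x\<close> is
(\<open>commutative_if_D_nilpotent\<close>).

It is essential to use all powers of \<open>D\<close>: over the reals the single equation \<open>tr D = 0\<close> can hold,
for instance when \<open>B\<close> is the imaginary part of the complex Killing form.
\<close>

section \<open>Traces and nilpotency of matrices\<close>

definition mat_trace :: "'a::comm_ring_1 mat \<Rightarrow> 'a" where
  "mat_trace A = (\<Sum>i<dim_row A. A $$ (i,i))"

lemma mult_mat_entry:
  assumes "A \<in> carrier_mat n n" "B \<in> carrier_mat n n" "i < n" "j < n"
  shows "(A * B) $$ (i,j) = (\<Sum>k<n. A $$ (i,k) * B $$ (k,j))"
  using assms by (simp add: scalar_prod_def lessThan_atLeast0)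

lemma mat_trace_mult_comm:
  assumes "A \<in> carrier_mat n n" "B \<in> carrier_mat n n"
  shows "mat_trace (A * B) = mat_trace (B * A)"
proof -
  have "mat_trace (A * B) = (\<Sum>i<n. \<Sum>k<n. A $$ (i,k) * B $$ (k,i))"
    using assms by (simp add: mat_trace_def scalar_prod_def lessThan_atLeast0)
  also have "\<dots> = (\<Sum>k<n. \<Sum>i<n. B $$ (k,i) * A $$ (i,k))"
    by (subst sum.swap) (simp add: mult.commute)
  also have "\<dots> = mat_trace (B * A)"
    using assms by (simp add: mat_trace_def scalar_prod_def lessThan_atLeast0)
  finally show ?thesis .
qed

lemma mat_trace_zero [simp]: "mat_trace (0\<^sub>m n n) = 0"
  by (simp add: mat_trace_def)

lemma mat_trace_add: "A \<in> carrier_mat n n \<Longrightarrow> B \<in> carrier_mat n n \<Longrightarrow> mat_trace (A + B) = mat_trace A + mat_trace B"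
  by (simp add: mat_trace_def sum.distrib)

lemma mat_trace_minus: "A \<in> carrier_mat n n \<Longrightarrow> B \<in> carrier_mat n n \<Longrightarrow> mat_trace (A - B) = mat_trace A - mat_trace B"
  by (simp add: mat_trace_def sum_subtractf)

lemma mat_trace_smult: "A \<in> carrier_mat n n \<Longrightarrow> mat_trace (c \<cdot>\<^sub>m A) = c * mat_trace A"
  by (simp add: mat_trace_def sum_distrib_left)

lemma mat_trace_of_real: "mat_trace (map_mat complex_of_real A) = of_real (mat_trace A)" if "A \<in> carrier_mat n n"
  using that by (simp add: mat_trace_def)

text \<open>
A nonzero entry joins two indices of the same Jordan block, and the diagonal is constant on a block.
\<close>

lemma jordan_matrix_block_diagonal:
  assumes "i < sum_list (map fst js)" "j < sum_list (map fst js)" "jordan_matrix js $$ (i,j) \<noteq> 0"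
  shows "jordan_matrix js $$ (i,i) = jordan_matrix js $$ (j,j)"
  using assms
proof (induction js arbitrary: i j)
  case Nil
  then show ?case by simp
next
  case (Cons na js)
  obtain n a where na: "na = (n, a)" by force
  let ?m = "sum_list (map fst js)"
  have eq: "jordan_matrix ((n, a) # js) $$ (i, j) =
    (if i < n then if j < n then jordan_block n a $$ (i, j) else 0
     else if j < n then 0 else jordan_matrix js $$ (i - n, j - n))"
    if "i < n + ?m" "j < n + ?m" for i j
    using that unfolding jordan_matrix_Cons by (auto simp: jordan_matrix_dim)
  show ?case
    using Cons.prems Cons.IH[of "i - n" "j - n"] by (auto simp: eq na split: if_splits)
qed

text \<open>
The only features of the Jordan normal form that matter below: it is upper triangular, and its diagonal
part commutes with it (which is what equality of the two diagonal entries says).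
\<close>

lemma complex_jordan_decomposition:
  fixes A :: "complex mat"
  assumes A: "A \<in> carrier_mat n n"
  obtains P Q T where "similar_mat_wit A T P Q" "T \<in> carrier_mat n n"
    "\<forall>i<n. \<forall>j<n. T $$ (i,j) \<noteq> 0 \<longrightarrow> i \<le> j \<and> T $$ (i,i) = T $$ (j,j)"
proof -
  obtain js where "jordan_nf A js"
    using char_poly_factorized[OF A] jordan_nf_exists[OF A] by blast
  then obtain P Q where w: "similar_mat_wit A (jordan_matrix js) P Q"
    by (auto simp: jordan_nf_def similar_mat_def)
  have c: "jordan_matrix js \<in> carrier_mat n n" using similar_mat_witD2[OF A w] by simp
  then have n: "sum_list (map fst js) = n" by (metis carrier_matD(1) jordan_matrix_dim(1))
  show thesis
  proof (rule that[OF w c], intro allI impI)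
    fix i j assume ij: "i < n" "j < n" "jordan_matrix js $$ (i,j) \<noteq> 0"
    then have "i \<le> j"
      using jordan_matrix_upper_triangular[of i js j] n by (meson not_le)
    then show "i \<le> j \<and> jordan_matrix js $$ (i,i) = jordan_matrix js $$ (j,j)"
      using jordan_matrix_block_diagonal[of i js j] ij n by simp
  qed
qed

lemma upper_triangular_power:
  fixes T :: "'a::comm_ring_1 mat"
  assumes T: "T \<in> carrier_mat n n" and ut: "\<And>i j. j < i \<Longrightarrow> i < n \<Longrightarrow> T $$ (i,j) = 0"
  shows "i < n \<Longrightarrow> j < i \<Longrightarrow> (T ^\<^sub>m k) $$ (i,j) = 0"
    and "i < n \<Longrightarrow> (T ^\<^sub>m k) $$ (i,i) = (T $$ (i,i)) ^ k"
proof (induction k arbitrary: i j)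
  case 0
  { case 1 then show ?case using T by simp }
  { case 2 then show ?case using T by simp }
next
  case (Suc k)
  have c: "T ^\<^sub>m k \<in> carrier_mat n n" using T by simp
  have e: "(T ^\<^sub>m Suc k) $$ (i,j) = (\<Sum>l<n. (T ^\<^sub>m k) $$ (i,l) * T $$ (l,j))" if "i < n" "j < n" for i j
    using that T c by (simp add: scalar_prod_def lessThan_atLeast0)
  { case 1
    have "(T ^\<^sub>m k) $$ (i,l) * T $$ (l,j) = 0" if "l < n" for l
      using 1 that Suc.IH(1)[of i l] ut[of j l] by (cases "l < i") auto
    then show ?case using 1 by (subst e) (auto intro!: sum.neutral) }
  { case 2
    have "(T ^\<^sub>m k) $$ (i,l) * T $$ (l,i) = 0" if "l < n" "l \<noteq> i" for l
      using 2 that Suc.IH(1)[of i l] ut[of i l] by (cases "l < i") auto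
    then have "(T ^\<^sub>m Suc k) $$ (i,i) = (\<Sum>l<n. if l = i then (T ^\<^sub>m k) $$ (i,i) * T $$ (i,i) else 0)"
      unfolding e[OF 2 2] by (intro sum.cong) auto
    then show ?case using 2 Suc.IH(2) by (simp add: mult.commute) }
qed

lemma strictly_upper_triangular_power:
  fixes T :: "'a::comm_ring_1 mat"
  assumes T: "T \<in> carrier_mat n n" and ut: "\<And>i j. j \<le> i \<Longrightarrow> i < n \<Longrightarrow> T $$ (i,j) = 0"
  shows "i < n \<Longrightarrow> j < n \<Longrightarrow> j < i + k \<Longrightarrow> (T ^\<^sub>m k) $$ (i,j) = 0"
proof (induction k arbitrary: j)
  case 0
  then show ?case using T by simp
next
  case (Suc k)
  have c: "T ^\<^sub>m k \<in> carrier_mat n n" using T by simp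
  have "(T ^\<^sub>m Suc k) $$ (i,j) = (\<Sum>l<n. (T ^\<^sub>m k) $$ (i,l) * T $$ (l,j))"
    using Suc.prems T c by (simp add: scalar_prod_def lessThan_atLeast0)
  also have "\<dots> = 0"
  proof (rule sum.neutral, rule ballI)
    fix l assume "l \<in> {..<n}"
    then show "(T ^\<^sub>m k) $$ (i,l) * T $$ (l,j) = 0"
      using Suc.IH[of l] Suc.prems ut[of j l] by (cases "j \<le> l") auto
  qed
  finally show ?case .
qed

text \<open>
The diagonal of the Jordan form, as a list of eigenvalues through which traces of powers and nilpotency
are both expressed.
\<close>

lemma complex_eigenvalues:
  fixes A :: "complex mat"
  assumes A: "A \<in> carrier_mat n n"
  obtains ev :: "nat \<Rightarrow> complex"
  where "\<forall>k. mat_trace (A ^\<^sub>m k) = (\<Sum>i<n. ev i ^ k)"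
    and "(\<forall>i<n. ev i = 0) \<longrightarrow> A ^\<^sub>m n = 0\<^sub>m n n"
    and "\<forall>k. A ^\<^sub>m k = 0\<^sub>m n n \<longrightarrow> (\<forall>i<n. ev i = 0)"
proof -
  obtain P Q T where w: "similar_mat_wit A T P Q" and T: "T \<in> carrier_mat n n"
    and tri: "\<forall>i<n. \<forall>j<n. T $$ (i,j) \<noteq> 0 \<longrightarrow> i \<le> j \<and> T $$ (i,i) = T $$ (j,j)"
    using complex_jordan_decomposition[OF A] .
  note wit = similar_mat_witD2[OF A w]
  have ut: "T $$ (i,j) = 0" if "j < i" "i < n" for i j
    using tri that by (metis not_le order.strict_trans)
  have pow: "A ^\<^sub>m k = P * T ^\<^sub>m k * Q" for k
    using similar_mat_wit_pow_id[OF w] .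
  have powT: "T ^\<^sub>m k = Q * A ^\<^sub>m k * P" for k
    using similar_mat_wit_pow_id[OF similar_mat_wit_sym[OF w]] .
  have Tk: "T ^\<^sub>m k \<in> carrier_mat n n" for k using T by simp
  have tr: "mat_trace (A ^\<^sub>m k) = (\<Sum>i<n. (T $$ (i,i)) ^ k)" for k
  proof -
    have "mat_trace (A ^\<^sub>m k) = mat_trace (Q * (P * T ^\<^sub>m k))"
      unfolding pow using wit Tk[of k] by (intro mat_trace_mult_comm[of _ n]) auto
    also have "Q * (P * T ^\<^sub>m k) = T ^\<^sub>m k"
      using wit Tk[of k] by (simp flip: assoc_mult_mat[of Q n n P n _ n])
    also have "mat_trace (T ^\<^sub>m k) = (\<Sum>i<n. (T $$ (i,i)) ^ k)"
      using Tk[of k] T upper_triangular_power(2)[OF T ut] by (simp add: mat_trace_def)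
    finally show ?thesis .
  qed
  show thesis
  proof (rule that[of "\<lambda>i. T $$ (i,i)"])
    show "\<forall>k. mat_trace (A ^\<^sub>m k) = (\<Sum>i<n. (T $$ (i,i)) ^ k)" using tr by blast
  next
    show "(\<forall>i<n. T $$ (i,i) = 0) \<longrightarrow> A ^\<^sub>m n = 0\<^sub>m n n"
    proof
      assume z: "\<forall>i<n. T $$ (i,i) = 0"
      have sut: "T $$ (i,j) = 0" if "j \<le> i" "i < n" for i j
        using that z ut by (cases "j = i") auto
      have "T ^\<^sub>m n = 0\<^sub>m n n"
        using Tk[of n] strictly_upper_triangular_power[OF T sut, of _ _ n] by (intro eq_matI) auto
      then show "A ^\<^sub>m n = 0\<^sub>m n n" unfolding pow using wit by simp
    qed
  next
    show "\<forall>k. A ^\<^sub>m k = 0\<^sub>m n n \<longrightarrow> (\<forall>i<n. T $$ (i,i) = 0)"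
    proof (intro allI impI)
      fix k i assume "A ^\<^sub>m k = 0\<^sub>m n n" and i: "i < n"
      then have "T ^\<^sub>m k = 0\<^sub>m n n" unfolding powT using wit by simp
      then show "T $$ (i,i) = 0"
        using upper_triangular_power(2)[OF T ut i, of k] i by simp
    qed
  qed
qed

lemma of_real_mat_pow:
  fixes A :: "real mat"
  assumes "A \<in> carrier_mat n n"
  shows "map_mat complex_of_real (A ^\<^sub>m k) = map_mat complex_of_real A ^\<^sub>m k"
  using of_real_hom.mat_hom_pow[OF assms] .

lemma of_real_mat_eq_0:
  fixes A :: "real mat"
  assumes "A \<in> carrier_mat n n"
  shows "map_mat complex_of_real A = 0\<^sub>m n n \<longleftrightarrow> A = 0\<^sub>m n n"
  using assms by (auto simp: mat_eq_iff)

lemma mat_trace_nilpotent: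
  fixes A :: "real mat"
  assumes A: "A \<in> carrier_mat n n" and nil: "A ^\<^sub>m k = 0\<^sub>m n n"
  shows "mat_trace A = 0"
proof -
  let ?A = "map_mat complex_of_real A"
  have cA: "?A \<in> carrier_mat n n" using A by simp
  obtain l where l: "\<forall>k. mat_trace (?A ^\<^sub>m k) = (\<Sum>i<n. l i ^ k)"
    "(\<forall>i<n. l i = 0) \<longrightarrow> ?A ^\<^sub>m n = 0\<^sub>m n n"
    "\<forall>k. ?A ^\<^sub>m k = 0\<^sub>m n n \<longrightarrow> (\<forall>i<n. l i = 0)"
    using complex_eigenvalues[OF cA] .
  have "?A ^\<^sub>m k = 0\<^sub>m n n"
    using nil of_real_mat_pow[OF A, of k] of_real_mat_eq_0[of "A ^\<^sub>m k" n] A by simp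
  then have "\<forall>i<n. l i = 0" using l(3) by blast
  then have "mat_trace (?A ^\<^sub>m 1) = 0" using l(1)[rule_format, of 1] by simp
  moreover have "?A ^\<^sub>m 1 = ?A" using cA by simp
  ultimately show ?thesis using mat_trace_of_real[OF A] by simp
qed

text \<open>
If all power sums vanish, so does \<open>\<Sum> l\<^sub>j q(l\<^sub>j)\<close> for every polynomial \<open>q\<close>. Choosing \<open>q\<close> to vanish at all
values other than \<open>l\<^sub>i\<close> leaves a nonzero multiple of \<open>l\<^sub>i\<close>.
\<close>

lemma power_sums_zero:
  fixes l :: "nat \<Rightarrow> complex"
  assumes z: "\<And>k. k \<ge> 1 \<Longrightarrow> (\<Sum>i<n. l i ^ k) = 0" and i: "i < n"
  shows "l i = 0"
proof (rule ccontr)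
  assume nz: "l i \<noteq> 0"
  define F where "F = l ` {..<n} - {l i}"
  define p where "p = (\<Prod>\<nu>\<in>F. [:- \<nu>, 1:])"
  have fin: "finite F" by (simp add: F_def)
  have p0: "poly p (l j) = 0" if "j < n" "l j \<noteq> l i" for j
    using that fin unfolding p_def poly_prod
    by (intro prod_zero) (auto simp: F_def)
  have p1: "poly p (l i) \<noteq> 0"
    unfolding p_def poly_prod using fin by (auto simp: F_def)
  have "(\<Sum>j<n. l j * poly p (l j)) = (\<Sum>j<n. \<Sum>k\<le>degree p. coeff p k * l j ^ Suc k)"
    by (simp add: poly_altdef sum_distrib_left mult_ac)
  also have "\<dots> = (\<Sum>k\<le>degree p. coeff p k * (\<Sum>j<n. l j ^ Suc k))"
    by (subst sum.swap) (simp add: sum_distrib_left)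
  also have "\<dots> = 0" using z by (intro sum.neutral ballI) (metis One_nat_def Suc_le_mono le0 mult_zero_right)
  finally have "0 = (\<Sum>j<n. l j * poly p (l j))" by simp
  also have "\<dots> = (\<Sum>j\<in>{j\<in>{..<n}. l j = l i}. l i * poly p (l i))"
    using p0 by (intro sum.mono_neutral_cong_right) auto
  also have "\<dots> = of_nat (card {j\<in>{..<n}. l j = l i}) * (l i * poly p (l i))" by simp
  also have "\<dots> \<noteq> 0" using nz p1 i by (auto simp: card_eq_0_iff)
  finally show False by simp
qed

lemma nilpotent_if_power_traces_zero:
  fixes A :: "real mat"
  assumes A: "A \<in> carrier_mat n n" and z: "\<And>k. k \<ge> 1 \<Longrightarrow> mat_trace (A ^\<^sub>m k) = 0"
  shows "A ^\<^sub>m n = 0\<^sub>m n n"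
proof -
  let ?A = "map_mat complex_of_real A"
  have cA: "?A \<in> carrier_mat n n" using A by simp
  obtain l where l: "\<forall>k. mat_trace (?A ^\<^sub>m k) = (\<Sum>i<n. l i ^ k)"
    "(\<forall>i<n. l i = 0) \<longrightarrow> ?A ^\<^sub>m n = 0\<^sub>m n n"
    "\<forall>k. ?A ^\<^sub>m k = 0\<^sub>m n n \<longrightarrow> (\<forall>i<n. l i = 0)"
    using complex_eigenvalues[OF cA] .
  have "(\<Sum>i<n. l i ^ k) = 0" if "k \<ge> 1" for k
    using z[OF that] l(1)[rule_format, of k] of_real_mat_pow[OF A, of k] mat_trace_of_real[of "A ^\<^sub>m k" n] A by simp
  then have "?A ^\<^sub>m n = 0\<^sub>m n n" using power_sums_zero[of l n] l(2) by blast
  then show ?thesis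
    using of_real_mat_pow[OF A, of n] of_real_mat_eq_0[of "A ^\<^sub>m n" n] A by simp
qed

section \<open>Generalized eigencomponents\<close>

context Vector_Spaces.vector_space
begin

context
  fixes f :: "'b \<Rightarrow> 'b" and U :: "'b set"
  assumes lin: "Vector_Spaces.linear scale scale f"
    and U: "subspace U" and stable: "\<And>x. x \<in> U \<Longrightarrow> f x \<in> U"
begin

interpretation f: Vector_Spaces.linear scale scale f by (fact lin)

abbreviation shifted where "shifted \<nu> \<equiv> (\<lambda>x. f x - scale \<nu> x)"

lemma shifted_linear: "Vector_Spaces.linear scale scale ((shifted \<mu>) ^^ m)"
proof (induction m)
  case 0
  then show ?case using linear_id by (simp add: id_def)
next
  case (Suc m)
  have "Vector_Spaces.linear scale scale (shifted \<mu>)"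
    by unfold_locales (simp_all add: f.add f.scale scale_right_distrib
        scale_right_diff_distrib mult.commute)
  with Suc show ?case unfolding funpow.simps by (rule Vector_Spaces.linear_compose)
qed

lemma shifted_commute: "shifted \<mu> (shifted \<nu> x) = shifted \<nu> (shifted \<mu> x)"
  by (simp add: f.diff f.scale scale_right_diff_distrib mult.commute)

lemma shifted_pow_commute1: "((shifted \<mu>) ^^ m) (shifted \<nu> x) = shifted \<nu> (((shifted \<mu>) ^^ m) x)"
  by (induction m) (simp_all add: shifted_commute)

lemma shifted_pow_commute:
  "((shifted \<mu>) ^^ m) (((shifted \<nu>) ^^ k) x) = ((shifted \<nu>) ^^ k) (((shifted \<mu>) ^^ m) x)"
  by (induction k) (simp_all add: shifted_pow_commute1)

lemma shifted_stable: "x \<in> U \<Longrightarrow> ((shifted \<mu>) ^^ m) x \<in> U"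
  by (induction m) (auto intro!: subspace_diff[OF U] subspace_scale[OF U] stable)

text \<open>
On a generalized eigenvector for \<open>\<nu>\<close>, the operator \<open>f - \<mu>\<close> with \<open>\<mu> \<noteq> \<nu>\<close> is invertible modulo \<open>U\<close>: by
induction \<open>(f - \<nu>) y\<close> lies in \<open>U\<close>, and the difference of the two shifts is a nonzero scalar.
\<close>

lemma mem_if_shifted_mem:
  assumes "((shifted \<nu>) ^^ k) y = 0" "shifted \<mu> y \<in> U" "\<mu> \<noteq> \<nu>"
  shows "y \<in> U"
  using assms(1,2)
proof (induction k arbitrary: y)
  case 0
  then show ?case using U by (simp add: subspace_0)
next
  case (Suc k)
  have "shifted \<mu> (shifted \<nu> y) = shifted \<nu> (shifted \<mu> y)" by (rule shifted_commute)
  then have "shifted \<mu> (shifted \<nu> y) \<in> U"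
    using shifted_stable[OF Suc.prems(2), of 1 \<nu>] by simp
  moreover have "((shifted \<nu>) ^^ k) (shifted \<nu> y) = 0"
    using Suc.prems(1) by (simp only: funpow_Suc_right o_apply)
  ultimately have "shifted \<nu> y \<in> U" using Suc.IH by blast
  from subspace_diff[OF U Suc.prems(2) this]
  have "scale (\<nu> - \<mu>) y \<in> U" by (simp add: scale_left_diff_distrib)
  then have "scale (inverse (\<nu> - \<mu>)) (scale (\<nu> - \<mu>) y) \<in> U" by (rule subspace_scale[OF U])
  then show ?case using assms(3) by simp
qed

lemma mem_if_shifted_pow_mem:
  assumes "((shifted \<nu>) ^^ k) y = 0" "((shifted \<mu>) ^^ m) y \<in> U" "\<mu> \<noteq> \<nu>"
  shows "y \<in> U"
  using assms(1,2)
proof (induction m arbitrary: y)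
  case 0
  then show ?case by simp
next
  case (Suc m)
  have "((shifted \<nu>) ^^ k) (shifted \<mu> y) = 0"
    unfolding shifted_pow_commute1 Suc.prems(1) by (simp add: f.zero)
  moreover have "((shifted \<mu>) ^^ m) (shifted \<mu> y) \<in> U"
    using Suc.prems(2) by (simp only: funpow_Suc_right o_apply)
  ultimately have "shifted \<mu> y \<in> U" using Suc.IH by blast
  then show ?case using mem_if_shifted_mem[OF Suc.prems(1)] assms(3) by blast
qed

text \<open>
An invariant subspace contains the generalized eigencomponents of its elements. Applying a power of
\<open>f - \<mu>\<close> removes one component from the sum; the lemma before recovers the others.
\<close>

lemma generalized_eigencomponents_mem:
  assumes "finite I" and "\<And>\<nu>. \<nu> \<in> I \<Longrightarrow> \<exists>m. ((shifted \<nu>) ^^ m) (X \<nu>) = 0"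
    and "(\<Sum>\<nu>\<in>I. X \<nu>) \<in> U"
  shows "\<forall>\<nu>\<in>I. X \<nu> \<in> U"
  using assms
proof (induction I arbitrary: X rule: finite_induct)
  case empty
  then show ?case by simp
next
  case (insert \<mu> I)
  obtain m where m: "((shifted \<mu>) ^^ m) (X \<mu>) = 0" using insert.prems(1) by blast
  interpret g: Vector_Spaces.linear scale scale "(shifted \<mu>) ^^ m" by (rule shifted_linear)
  have "(\<Sum>\<nu>\<in>I. ((shifted \<mu>) ^^ m) (X \<nu>)) = ((shifted \<mu>) ^^ m) (\<Sum>\<nu>\<in>insert \<mu> I. X \<nu>)"
    using insert.hyps m by (simp add: g.add g.sum)
  also have "\<dots> \<in> U" by (rule shifted_stable) (rule insert.prems(2))
  finally have s: "(\<Sum>\<nu>\<in>I. ((shifted \<mu>) ^^ m) (X \<nu>)) \<in> U" .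
  have "\<forall>\<nu>\<in>I. ((shifted \<mu>) ^^ m) (X \<nu>) \<in> U"
  proof (rule insert.IH[OF _ s])
    fix \<nu> assume "\<nu> \<in> I"
    then obtain k where "((shifted \<nu>) ^^ k) (X \<nu>) = 0" using insert.prems(1) by blast
    moreover have "((shifted \<nu>) ^^ k) (((shifted \<mu>) ^^ m) (X \<nu>)) =
      ((shifted \<mu>) ^^ m) (((shifted \<nu>) ^^ k) (X \<nu>))" by (rule shifted_pow_commute)
    ultimately have "((shifted \<nu>) ^^ k) (((shifted \<mu>) ^^ m) (X \<nu>)) = 0"
      by (simp add: g.zero)
    then show "\<exists>k. ((shifted \<nu>) ^^ k) (((shifted \<mu>) ^^ m) (X \<nu>)) = 0" by blast
  qed
  then have I: "\<forall>\<nu>\<in>I. X \<nu> \<in> U"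
    using insert.prems(1) insert.hyps(2) mem_if_shifted_pow_mem by (metis insertCI)
  have "X \<mu> = (\<Sum>\<nu>\<in>insert \<mu> I. X \<nu>) - (\<Sum>\<nu>\<in>I. X \<nu>)" using insert.hyps by simp
  also have "\<dots> \<in> U"
    using I by (intro subspace_diff[OF U] insert.prems(2) subspace_sum[OF U]) auto
  finally show ?case using I by simp
qed

end

end


section \<open>Nilpotency from a vanishing trace form\<close>

lemma sum_fun2_apply: "(\<Sum>a\<in>I. F a) i j = (\<Sum>a\<in>I. F a i j)"
  for F :: "'a \<Rightarrow> 'i \<Rightarrow> 'j \<Rightarrow> 'b::ab_group_add"
  by (induction I rule: infinite_finite_induct) simp_all

interpretation entries: Vector_Spaces.vector_space
  "\<lambda>(c::complex) (F :: nat \<Rightarrow> nat \<Rightarrow> complex) i j. c * F i j"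
  by unfold_locales (auto simp: fun_eq_iff algebra_simps)

text \<open>
Let \<open>D\<close> be the diagonal matrix with the conjugate eigenvalues of \<open>T\<close>. The matrix in the conclusion is
\<open>[D, X]\<close>: the entries of \<open>X\<close> with \<open>t\<^sub>i - t\<^sub>j = \<nu>\<close> form its generalized eigencomponent for \<open>[T, _]\<close>, and
\<open>[D, _]\<close> multiplies that component by the conjugate of \<open>\<nu>\<close>. So every space stable under \<open>[T, _]\<close> is stable
under \<open>[D, _]\<close>.
\<close>

lemma diagonal_commutator_mem:
  fixes T :: "complex mat" and S :: "complex mat set"
  assumes T: "T \<in> carrier_mat n n"
    and tri: "\<forall>i<n. \<forall>j<n. T $$ (i,j) \<noteq> 0 \<longrightarrow> i \<le> j \<and> T $$ (i,i) = T $$ (j,j)"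
    and S: "S \<subseteq> carrier_mat n n" and S0: "0\<^sub>m n n \<in> S"
    and add: "\<And>X Y. X \<in> S \<Longrightarrow> Y \<in> S \<Longrightarrow> X + Y \<in> S"
    and smult: "\<And>c X. X \<in> S \<Longrightarrow> c \<cdot>\<^sub>m X \<in> S"
    and comm: "\<And>X. X \<in> S \<Longrightarrow> T * X - X * T \<in> S"
    and X: "X \<in> S"
  shows "mat n n (\<lambda>(i,j). cnj (T $$ (i,i) - T $$ (j,j)) * X $$ (i,j)) \<in> S"
proof -
  define fn :: "complex mat \<Rightarrow> nat \<Rightarrow> nat \<Rightarrow> complex"
    where "fn M = (\<lambda>i j. if i < n \<and> j < n then M $$ (i,j) else 0)" for M
  define U where "U = fn ` S"
  define t where "t i = T $$ (i,i)" for i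
  define f :: "(nat \<Rightarrow> nat \<Rightarrow> complex) \<Rightarrow> nat \<Rightarrow> nat \<Rightarrow> complex"
    where "f Y = (\<lambda>i j. if i < n \<and> j < n then (\<Sum>k<n. T $$ (i,k) * Y k j) - (\<Sum>k<n. Y i k * T $$ (k,j)) else 0)" for Y
  define sc :: "complex \<Rightarrow> (nat \<Rightarrow> nat \<Rightarrow> complex) \<Rightarrow> nat \<Rightarrow> nat \<Rightarrow> complex"
    where "sc = (\<lambda>c F i j. c * F i j)"
  have lin: "Vector_Spaces.linear sc sc f"
    unfolding sc_def
    by unfold_locales (auto simp: f_def fun_eq_iff algebra_simps sum.distrib sum_distrib_left)
  have car: "M \<in> carrier_mat n n" if "M \<in> S" for M using that S by blast
  have fn_add: "fn (M + N) = fn M + fn N" if "M \<in> S" "N \<in> S" for M N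
    using car[OF that(1)] car[OF that(2)] by (auto simp: fn_def fun_eq_iff)
  have fn_smult: "fn (c \<cdot>\<^sub>m M) = sc c (fn M)" if "M \<in> S" for c M
    using car[OF that] by (auto simp: fn_def fun_eq_iff sc_def)
  have U: "entries.subspace U"
    unfolding entries.subspace_def U_def
  proof (intro conjI ballI allI)
    have "fn (0\<^sub>m n n) = 0" by (auto simp: fn_def fun_eq_iff)
    then show "0 \<in> fn ` S" using S0 by (metis imageI)
  next
    fix x y assume "x \<in> fn ` S" "y \<in> fn ` S"
    then show "x + y \<in> fn ` S" using fn_add add by (auto simp flip: fn_add)
  next
    fix c x assume "x \<in> fn ` S"
    then obtain M where M: "M \<in> S" "x = fn M" by blast
    then have "(\<lambda>i j. c * x i j) = fn (c \<cdot>\<^sub>m M)" using fn_smult by (simp add: sc_def)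
    then show "(\<lambda>i j. c * x i j) \<in> fn ` S" using smult[OF M(1)] by simp
  qed
  have fU: "f x \<in> U" if x: "x \<in> U" for x
  proof -
    obtain M where M: "M \<in> S" "x = fn M" using x unfolding U_def by blast
    have "f x = fn (T * M - M * T)"
      using car[OF M(1)] T unfolding M(2)
      by (auto simp: f_def fn_def fun_eq_iff scalar_prod_def lessThan_atLeast0)
    then show ?thesis using comm[OF M(1)] by (simp add: U_def)
  qed
  \<comment> \<open>the part of \<open>X\<close> on which \<open>[T, _]\<close> has the generalized eigenvalue \<open>\<nu>\<close>\<close>
  define C where "C \<nu> = (\<lambda>i j. if i < n \<and> j < n \<and> t i - t j = \<nu> then X $$ (i,j) else 0)" for \<nu>
  define I where "I = (\<lambda>(i,j). t i - t j) ` ({..<n} \<times> {..<n})"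
  have fin: "finite I" by (simp add: I_def)
  have sumC: "(\<Sum>\<nu>\<in>I. g \<nu> * C \<nu> i j) = (if i < n \<and> j < n then g (t i - t j) * X $$ (i,j) else 0)" for g i j
  proof (cases "i < n \<and> j < n")
    case True
    then have "t i - t j \<in> I" by (auto simp: I_def)
    moreover have "(\<Sum>\<nu>\<in>I. g \<nu> * C \<nu> i j) = (\<Sum>\<nu>\<in>I. if \<nu> = t i - t j then g (t i - t j) * X $$ (i,j) else 0)"
      using True by (intro sum.cong) (auto simp: C_def)
    ultimately show ?thesis using True fin by simp
  next
    case False
    then show ?thesis by (auto simp: C_def intro!: sum.neutral)
  qed
  have nil: "\<exists>m. ((\<lambda>x. f x - sc \<nu> x) ^^ m) (C \<nu>) = 0" for \<nu>
  proof -
    define D where "D c = {Y :: nat \<Rightarrow> nat \<Rightarrow> complex. \<forall>i j. Y i j \<noteq> 0 \<longrightarrow> i < n \<and> j < n \<and> t i - t j = \<nu> \<and> i + c \<le> j + n}" for c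
    have step: "f Y - sc \<nu> Y \<in> D (Suc c)" if Y: "Y \<in> D c" for Y c
    proof -
      have "i < n \<and> j < n \<and> t i - t j = \<nu> \<and> i + Suc c \<le> j + n" if nz: "(f Y - sc \<nu> Y) i j \<noteq> 0" for i j
      proof -
        have Y0: "i < n \<and> j < n \<and> t i - t j = \<nu> \<and> i + c \<le> j + n" if "Y i j \<noteq> 0" for i j
          using Y that by (auto simp: D_def)
        have ij: "i < n" "j < n" using nz Y0[of i j] by (auto simp: f_def sc_def split: if_splits)
        have "(\<Sum>k<n. T $$ (i,k) * Y k j) = T $$ (i,i) * Y i j + (\<Sum>k\<in>{..<n} - {i}. T $$ (i,k) * Y k j)"
          using ij by (subst sum.remove[of _ i]) auto
        moreover have "(\<Sum>k<n. Y i k * T $$ (k,j)) = Y i j * T $$ (j,j) + (\<Sum>k\<in>{..<n} - {j}. Y i k * T $$ (k,j))"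
          using ij by (subst sum.remove[of _ j]) auto
        moreover have "\<nu> * Y i j = t i * Y i j - Y i j * t j"
          using Y0[of i j] by (cases "Y i j = 0") (auto simp: algebra_simps)
        ultimately have "(f Y - sc \<nu> Y) i j =
          (\<Sum>k\<in>{..<n} - {i}. T $$ (i,k) * Y k j) - (\<Sum>k\<in>{..<n} - {j}. Y i k * T $$ (k,j))"
          using ij by (simp add: f_def sc_def t_def)
        with nz have "(\<Sum>k\<in>{..<n} - {i}. T $$ (i,k) * Y k j) \<noteq> 0 \<or> (\<Sum>k\<in>{..<n} - {j}. Y i k * T $$ (k,j)) \<noteq> 0"
          by auto
        then show ?thesis
        proof
          assume "(\<Sum>k\<in>{..<n} - {i}. T $$ (i,k) * Y k j) \<noteq> 0"
          then obtain k where "k \<in> {..<n} - {i}" "T $$ (i,k) * Y k j \<noteq> 0"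
            by (rule sum.not_neutral_contains_not_neutral)
          then have k: "k < n" "k \<noteq> i" "T $$ (i,k) \<noteq> 0" "Y k j \<noteq> 0" by auto
          with tri ij have "i \<le> k" "t i = t k" by (auto simp: t_def)
          with Y0[OF k(4)] k(2) ij show ?thesis by auto
        next
          assume "(\<Sum>k\<in>{..<n} - {j}. Y i k * T $$ (k,j)) \<noteq> 0"
          then obtain k where "k \<in> {..<n} - {j}" "Y i k * T $$ (k,j) \<noteq> 0"
            by (rule sum.not_neutral_contains_not_neutral)
          then have k: "k < n" "k \<noteq> j" "T $$ (k,j) \<noteq> 0" "Y i k \<noteq> 0" by auto
          with tri ij have "k \<le> j" "t k = t j" by (auto simp: t_def)
          with Y0[OF k(4)] k(2) ij show ?thesis by auto
        qed
      qed
      then show ?thesis by (auto simp: D_def)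
    qed
    have "((\<lambda>x. f x - sc \<nu> x) ^^ m) (C \<nu>) \<in> D m" for m
    proof (induction m)
      case 0
      show ?case by (auto simp: D_def C_def)
    next
      case (Suc m)
      show ?case using step[OF Suc] by (simp only: funpow.simps o_apply)
    qed
    from this[of "2 * n"] have "((\<lambda>x. f x - sc \<nu> x) ^^ (2 * n)) (C \<nu>) = 0"
      by (force simp: D_def fun_eq_iff)
    then show ?thesis by blast
  qed
  have "(\<Sum>\<nu>\<in>I. C \<nu>) = fn X"
    using sumC[of "\<lambda>_. 1"] by (auto simp: fun_eq_iff sum_fun2_apply fn_def)
  then have "(\<Sum>\<nu>\<in>I. C \<nu>) \<in> U" using X by (simp add: U_def)
  then have CU: "\<forall>\<nu>\<in>I. C \<nu> \<in> U"
    using entries.generalized_eigencomponents_mem[OF lin[unfolded sc_def] U fU fin, of C] nil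
    by (simp add: sc_def)
  define R where "R = mat n n (\<lambda>(i,j). cnj (T $$ (i,i) - T $$ (j,j)) * X $$ (i,j))"
  have "fn R = (\<Sum>\<nu>\<in>I. (\<lambda>i j. cnj \<nu> * C \<nu> i j))"
    using sumC[of cnj] by (auto simp: fun_eq_iff sum_fun2_apply fn_def R_def t_def)
  also have "\<dots> \<in> U"
    using CU by (intro entries.subspace_sum[OF U] entries.subspace_scale[OF U]) auto
  finally obtain M where M: "M \<in> S" "fn R = fn M" by (auto simp: U_def)
  have "R = M"
  proof (rule eq_matI)
    fix i j assume "i < dim_row M" "j < dim_col M"
    then have "i < n" "j < n" using car[OF M(1)] by auto
    then show "R $$ (i,j) = M $$ (i,j)" using fun_cong[OF fun_cong[OF M(2), of i], of j] by (simp add: fn_def)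
  qed (use car[OF M(1)] in \<open>auto simp: R_def\<close>)
  then show ?thesis using M(1) by (simp add: R_def)
qed


text \<open>
The key step of Cartan's criterion. The hypothesis \<open>brackets\<close> says that \<open>Z\<close> is a linear combination of
commutators of elements of \<open>S\<close>, in the form in which it is used. For the conjugate \<open>W\<close> of the semisimple
part of \<open>Z\<close>, the number \<open>tr (W Z) = \<Sum> |t\<^sub>i|\<^sup>2\<close> is a combination of
\<open>tr (W [X, Y]) = tr ([W, X] Y)\<close>, which vanish because \<open>[W, X]\<close> lies again in \<open>S\<close>.
\<close>

lemma nilpotent_if_trace_form_zero:
  fixes Z :: "complex mat" and S :: "complex mat set"
  assumes Z: "Z \<in> carrier_mat n n" and S: "S \<subseteq> carrier_mat n n" and S0: "0\<^sub>m n n \<in> S"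
    and add: "\<And>X Y. X \<in> S \<Longrightarrow> Y \<in> S \<Longrightarrow> X + Y \<in> S"
    and smult: "\<And>c X. X \<in> S \<Longrightarrow> c \<cdot>\<^sub>m X \<in> S"
    and comm: "\<And>X. X \<in> S \<Longrightarrow> Z * X - X * Z \<in> S"
    and tr: "\<And>X Y. X \<in> S \<Longrightarrow> Y \<in> S \<Longrightarrow> mat_trace (X * Y) = 0"
    and brackets: "\<And>W. W \<in> carrier_mat n n \<Longrightarrow>
      (\<And>X Y. X \<in> S \<Longrightarrow> Y \<in> S \<Longrightarrow> mat_trace (W * (X * Y - Y * X)) = 0) \<Longrightarrow> mat_trace (W * Z) = 0"
  shows "Z ^\<^sub>m n = 0\<^sub>m n n"
proof -
  obtain P Q T where w: "similar_mat_wit Z T P Q" and T: "T \<in> carrier_mat n n"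
    and tri: "\<forall>i<n. \<forall>j<n. T $$ (i,j) \<noteq> 0 \<longrightarrow> i \<le> j \<and> T $$ (i,i) = T $$ (j,j)"
    using complex_jordan_decomposition[OF Z] .
  note wit = similar_mat_witD2[OF Z w]
  have P: "P \<in> carrier_mat n n" and Q: "Q \<in> carrier_mat n n" using wit by auto
  have QP: "Q * (P * X) = X" and PQ: "P * (Q * X) = X" if "X \<in> carrier_mat n n" for X
    using that wit(1,2) P Q by (simp_all flip: assoc_mult_mat[of _ n n _ n _ n])
  note dist = minus_mult_distrib_mat[of _ n n _ _ n] mult_minus_distrib_mat[of _ n n _ n]
    add_mult_distrib_mat[of _ n n _ _ n] mult_add_distrib_mat[of _ n n _ n]
    mult_smult_distrib[of _ n n _ n] mult_smult_assoc_mat[of _ n n _ n]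
  note asc = assoc_mult_mat[of _ n n _ n _ n]
  have car: "X \<in> carrier_mat n n" if "X \<in> S" for X using that S by blast
  define S' where "S' = (\<lambda>X. Q * X * P) ` S"
  define D where "D = mat n n (\<lambda>(i,j). if i = j then cnj (T $$ (i,i)) else 0)"
  have D: "D \<in> carrier_mat n n" by (simp add: D_def)
  define W where "W = P * D * Q"
  have W: "W \<in> carrier_mat n n" using P Q D by (simp add: W_def)
  have comm_W: "W * X - X * W \<in> S" if X: "X \<in> S" for X
  proof -
    define Y where "Y = Q * X * P"
    have Y: "Y \<in> carrier_mat n n" using P Q car[OF X] by (simp add: Y_def)
    have "mat n n (\<lambda>(i,j). cnj (T $$ (i,i) - T $$ (j,j)) * Y $$ (i,j)) \<in> S'"
    proof (rule diagonal_commutator_mem[OF T tri])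
      show "S' \<subseteq> carrier_mat n n" using P Q car by (auto simp: S'_def)
      show "0\<^sub>m n n \<in> S'" unfolding S'_def using P Q S0
        by (intro image_eqI[of _ _ "0\<^sub>m n n"]) auto
      show "Y \<in> S'" using X by (simp add: S'_def Y_def)
    next
      fix A B assume "A \<in> S'" "B \<in> S'"
      then obtain A' B' where AB: "A' \<in> S" "B' \<in> S" "A = Q * A' * P" "B = Q * B' * P"
        by (auto simp: S'_def)
      then have "A + B = Q * (A' + B') * P" using P Q car[of A'] car[of B'] by (simp add: dist)
      then show "A + B \<in> S'" using AB add by (auto simp: S'_def)
    next
      fix c A assume "A \<in> S'"
      then obtain A' where A: "A' \<in> S" "A = Q * A' * P" by (auto simp: S'_def)
      then have "c \<cdot>\<^sub>m A = Q * (c \<cdot>\<^sub>m A') * P" using P Q car[of A'] by (simp add: dist)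
      then show "c \<cdot>\<^sub>m A \<in> S'" using A smult by (auto simp: S'_def)
    next
      fix A assume "A \<in> S'"
      then obtain A' where A: "A' \<in> S" "A = Q * A' * P" by (auto simp: S'_def)
      then have "T * A - A * T = Q * (Z * A' - A' * Z) * P"
        using P Q T car[of A'] wit(2,3) by (simp add: dist asc QP PQ)
      then show "T * A - A * T \<in> S'" using A comm by (auto simp: S'_def)
    qed
    then obtain M where M: "M \<in> S"
      "mat n n (\<lambda>(i,j). cnj (T $$ (i,i) - T $$ (j,j)) * Y $$ (i,j)) = Q * M * P"
      by (auto simp: S'_def)
    have "(D * Y) $$ (i,j) = cnj (T $$ (i,i)) * Y $$ (i,j)" "(Y * D) $$ (i,j) = Y $$ (i,j) * cnj (T $$ (j,j))"
      if "i < n" "j < n" for i j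
    proof -
      have "(D * Y) $$ (i,j) = (\<Sum>k<n. if k = i then cnj (T $$ (i,i)) * Y $$ (i,j) else 0)"
        unfolding mult_mat_entry[OF D Y that] using that by (intro sum.cong) (auto simp: D_def)
      then show "(D * Y) $$ (i,j) = cnj (T $$ (i,i)) * Y $$ (i,j)" using that by simp
      have "(Y * D) $$ (i,j) = (\<Sum>k<n. if k = j then Y $$ (i,j) * cnj (T $$ (j,j)) else 0)"
        unfolding mult_mat_entry[OF Y D that] using that by (intro sum.cong) (auto simp: D_def)
      then show "(Y * D) $$ (i,j) = Y $$ (i,j) * cnj (T $$ (j,j))" using that by simp
    qed
    then have "D * Y - Y * D = Q * M * P"
      unfolding M(2)[symmetric] using D Y by (intro eq_matI) (auto simp: algebra_simps)
    then have "P * (D * Y - Y * D) * Q = P * (Q * M * P) * Q" by simp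
    moreover have "P * (Q * M * P) * Q = M"
      using P Q car[OF M(1)] wit(1) by (simp add: asc PQ)
    moreover have "P * (D * Y - Y * D) * Q = W * X - X * W"
      using P Q D car[OF X] wit(1) unfolding Y_def W_def by (simp add: dist asc PQ)
    ultimately show ?thesis using M(1) by simp
  qed
  have "mat_trace (W * Z) = 0"
  proof (rule brackets[OF W])
    fix X Y assume XY: "X \<in> S" "Y \<in> S"
    note c = car[OF XY(1)] car[OF XY(2)] W
    have "mat_trace (W * (X * Y - Y * X)) = mat_trace (W * X * Y) - mat_trace ((W * Y) * X)"
      using c by (simp add: dist asc mat_trace_minus[of _ n])
    also have "mat_trace ((W * Y) * X) = mat_trace (X * (W * Y))"
      using c by (intro mat_trace_mult_comm[of _ n]) auto
    also have "mat_trace (W * X * Y) - mat_trace (X * (W * Y)) = mat_trace ((W * X - X * W) * Y)"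
      using c by (simp add: dist asc mat_trace_minus[of _ n])
    also have "\<dots> = 0" using comm_W[OF XY(1)] XY(2) by (rule tr)
    finally show "mat_trace (W * (X * Y - Y * X)) = 0" .
  qed
  moreover have "mat_trace (W * Z) = (\<Sum>i<n. of_real ((cmod (T $$ (i,i)))\<^sup>2))"
  proof -
    have "mat_trace (W * Z) = mat_trace (P * (D * T * Q))"
      using P Q D T wit(3) by (simp add: W_def asc QP)
    also have "\<dots> = mat_trace ((D * T * Q) * P)" using P Q D T by (intro mat_trace_mult_comm[of _ n]) auto
    also have "(D * T * Q) * P = D * T" using P Q D T wit(2) by (simp add: asc)
    also have "mat_trace (D * T) = (\<Sum>i<n. of_real ((cmod (T $$ (i,i)))\<^sup>2))"
    proof -
      have "(D * T) $$ (i,i) = (\<Sum>k<n. if k = i then cnj (T $$ (i,i)) * T $$ (i,i) else 0)" if "i < n" for i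
        unfolding mult_mat_entry[OF D T that that] using that by (intro sum.cong) (auto simp: D_def)
      then show ?thesis using D T by (simp add: mat_trace_def complex_norm_square mult.commute del: of_real_power)
    qed
    finally show ?thesis .
  qed
  ultimately have "(\<Sum>i<n. (cmod (T $$ (i,i)))\<^sup>2) = 0" by (simp flip: of_real_sum of_real_power)
  then have t0: "T $$ (i,i) = 0" if "i < n" for i
    using that by (simp add: sum_nonneg_eq_0_iff)
  have "T $$ (i,j) = 0" if "j \<le> i" "i < n" for i j
    using tri t0 that by (metis le_antisym order.strict_trans1)
  then have "T ^\<^sub>m n = 0\<^sub>m n n"
    using T strictly_upper_triangular_power[OF T, of _ _ n] by (intro eq_matI) auto
  then show ?thesis using similar_mat_wit_pow_id[OF w, of n] P Q by simp
qed

section \<open>Brackets, ideals and Engel's theorem\<close>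

context lie_algebra
begin

lemma bracket_zero_left [simp]: "bracket 0 x = 0"
  using bracket_add_left[of 0 0 x] by simp

lemma bracket_zero_right [simp]: "bracket x 0 = 0"
  using bracket_add_right[of x 0 0] by simp

lemma bracket_minus_left [simp]: "bracket (- x) y = - bracket x y"
  using bracket_add_left[of x "- x" y] by (simp add: add_eq_0_iff)

lemma bracket_minus_right [simp]: "bracket x (- y) = - bracket x y"
  using bracket_add_right[of x y "- y"] by (simp add: add_eq_0_iff)

lemma bracket_diff_left: "bracket (x - y) z = bracket x z - bracket y z"
  using bracket_add_left[of x "- y" z] by simp

lemma bracket_diff_right: "bracket z (x - y) = bracket z x - bracket z y"
  using bracket_add_right[of z x "- y"] by simp

lemma bracket_sum_right: "bracket x (\<Sum>e\<in>I. f e) = (\<Sum>e\<in>I. bracket x (f e))"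
  by (induction I rule: infinite_finite_induct) (simp_all add: bracket_add_right)

lemma bracket_skew: "bracket y x = - bracket x y"
proof -
  have "bracket (x + y) (x + y) = bracket x x + bracket x y + (bracket y x + bracket y y)"
    by (simp add: bracket_add_left bracket_add_right add_ac)
  then have "bracket x y + bracket y x = 0"
    by (simp add: bracket_self)
  then show ?thesis by (simp add: eq_neg_iff_add_eq_0 add.commute)
qed

lemma bracket_derivation: "bracket x (bracket y z) = bracket (bracket x y) z + bracket y (bracket x z)"
proof -
  have "bracket y (bracket z x) = - bracket y (bracket x z)"
    unfolding bracket_skew[of z x] by simp
  moreover have "bracket z (bracket x y) = - bracket (bracket x y) z" by (rule bracket_skew)
  ultimately show ?thesis using jacobi[of x y z] by (simp add: algebra_simps)
qed

lemma bracket_bracket: "bracket (bracket x y) z = bracket x (bracket y z) - bracket y (bracket x z)"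
  using bracket_derivation[of x y z] by simp

lemma subspace_commutator: "subspace (commutator a b)"
  by (simp add: commutator_def)

lemma bracket_mem_commutator: "x \<in> a \<Longrightarrow> y \<in> b \<Longrightarrow> bracket x y \<in> commutator a b"
  unfolding commutator_def by (rule span_base) blast

lemma commutator_least:
  "subspace U \<Longrightarrow> (\<And>x y. x \<in> a \<Longrightarrow> y \<in> b \<Longrightarrow> bracket x y \<in> U) \<Longrightarrow> commutator a b \<subseteq> U"
  unfolding commutator_def by (rule span_minimal) auto

lemma commutator_mono: "a \<subseteq> a' \<Longrightarrow> b \<subseteq> b' \<Longrightarrow> commutator a b \<subseteq> commutator a' b'"
  by (intro commutator_least subspace_commutator bracket_mem_commutator) auto

lemma subalgebra_subspace: "subalgebra h \<Longrightarrow> subspace h"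
  and subalgebra_bracket: "subalgebra h \<Longrightarrow> x \<in> h \<Longrightarrow> y \<in> h \<Longrightarrow> bracket x y \<in> h"
  by (auto simp: subalgebra_def)

lemma ideal_bracket: "ideal_of n h \<Longrightarrow> x \<in> h \<Longrightarrow> y \<in> n \<Longrightarrow> bracket x y \<in> n"
  and ideal_subspace: "ideal_of n h \<Longrightarrow> subspace n"
  and ideal_subset: "ideal_of n h \<Longrightarrow> n \<subseteq> h"
  by (auto simp: ideal_of_def)

lemma ideal_commutator:
  assumes h: "subalgebra h" and a: "ideal_of a h" and b: "ideal_of b h"
  shows "ideal_of (commutator a b) h"
  unfolding ideal_of_def
proof (intro conjI ballI subspace_commutator)
  show "commutator a b \<subseteq> h"
    using h ideal_subset[OF a] ideal_subset[OF b]
    by (intro commutator_least) (auto simp: subalgebra_def)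
next
  fix x y assume x: "x \<in> h" and y: "y \<in> commutator a b"
  have "subspace {y. bracket x y \<in> commutator a b}"
    using subspace_commutator[of a b]
    by (auto simp: subspace_def bracket_add_right bracket_scale_right)
  then have "commutator a b \<subseteq> {y. bracket x y \<in> commutator a b}"
  proof (rule commutator_least)
    fix u v assume uv: "u \<in> a" "v \<in> b"
    have "bracket (bracket x u) v \<in> commutator a b" "bracket u (bracket x v) \<in> commutator a b"
      using uv x a b by (auto intro!: bracket_mem_commutator ideal_bracket)
    then show "bracket u v \<in> {y. bracket x y \<in> commutator a b}"
      by (simp add: bracket_derivation[of x] subspace_add[OF subspace_commutator])
  qed
  then show "bracket x y \<in> commutator a b" using y by blast
qed

lemma ideal_self: "subalgebra h \<Longrightarrow> ideal_of h h"
  by (simp add: ideal_of_def subalgebra_def)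

lemma ideal_derived_series:
  assumes "subalgebra h" "ideal_of b h"
  shows "ideal_of (((\<lambda>a. commutator a a) ^^ k) b) h"
  by (induction k) (auto intro: assms ideal_commutator)

lemma subalgebra_commutator: "subalgebra h \<Longrightarrow> subalgebra (commutator h h)"
  using ideal_commutator[OF _ ideal_self ideal_self] by (auto simp: ideal_of_def subalgebra_def)

lemma derived_series_solvable:
  assumes "solvable (commutator s s)"
  shows "solvable s"
proof -
  obtain k where "((\<lambda>a. commutator a a) ^^ k) (commutator s s) = {0}"
    using assms by (auto simp: solvable_def)
  then have "((\<lambda>a. commutator a a) ^^ Suc k) s = {0}" by (simp only: funpow_Suc_right o_apply)
  then show ?thesis unfolding solvable_def by blast
qed

lemma subspace_lower_series: "subspace V \<Longrightarrow> subspace ((commutator m ^^ k) V)"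
  by (cases k) (simp_all add: subspace_commutator)

lemma lower_series_mono: "m \<subseteq> m' \<Longrightarrow> V \<subseteq> V' \<Longrightarrow> (commutator m ^^ k) V \<subseteq> (commutator m' ^^ k) V'"
  by (induction k) (simp_all add: commutator_mono)

lemma lower_series_decreasing: "(commutator m ^^ Suc k) UNIV \<subseteq> (commutator m ^^ k) UNIV"
  by (induction k) (simp_all add: commutator_mono)

text \<open>
The derived series is dominated by the iterated commutators with \<open>s\<close>.
\<close>

lemma solvable_if_lower_series:
  assumes s: "subalgebra s" and N: "(commutator s ^^ N) UNIV = {0}"
  shows "solvable s"
proof -
  let ?D = "\<lambda>k. ((\<lambda>a. commutator a a) ^^ k) s"
  have "?D k \<subseteq> s \<and> ?D k \<subseteq> (commutator s ^^ k) UNIV" for k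
  proof (induction k)
    case (Suc k)
    have "commutator (?D k) (?D k) \<subseteq> commutator s ((commutator s ^^ k) UNIV)"
      using Suc by (intro commutator_mono) auto
    moreover have "commutator (?D k) (?D k) \<subseteq> s"
      using Suc s by (intro commutator_least) (auto simp: subalgebra_def)
    ultimately show ?case by simp
  qed simp
  then have "?D N \<subseteq> {0}" using N by blast
  moreover have "subspace (?D N)"
    using ideal_derived_series[OF s ideal_self[OF s]] ideal_subspace by blast
  ultimately have "?D N = {0}" using subspace_0 by blast
  then show ?thesis unfolding solvable_def by blast
qed

text \<open>
The induction step of Engel's theorem. The spaces \<open>U k = [m, [m, ... ]]\<close> are stable under \<open>ad x\<close> because
\<open>x\<close> normalizes \<open>m\<close>, and on the quotient \<open>U k / U (k + 1)\<close> the enlarged algebra acts through multiples of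
\<open>ad x\<close> alone; so \<open>M\<close> brackets lead from \<open>U k\<close> into \<open>U (k + 1)\<close>.
\<close>

lemma lower_series_adjoin:
  assumes m: "subalgebra m" and norm: "\<And>a. a \<in> m \<Longrightarrow> bracket x a \<in> m"
    and x: "\<And>v. (bracket x ^^ M) v = 0"
  shows "(commutator {a + scale c x | a c. a \<in> m} ^^ (M * k)) UNIV \<subseteq> (commutator m ^^ k) UNIV"
proof -
  let ?m' = "{a + scale c x | a c. a \<in> m}"
  define U where "U k = (commutator m ^^ k) UNIV" for k
  have sub: "subspace (U k)" for k unfolding U_def by (rule subspace_lower_series) simp
  have dec: "U (Suc k) \<subseteq> U k" for k unfolding U_def by (rule lower_series_decreasing)
  have step: "bracket a u \<in> U (Suc k)" if "a \<in> m" "u \<in> U k" for a u k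
    using that by (simp add: U_def bracket_mem_commutator)
  have xU: "bracket x u \<in> U k" if "u \<in> U k" for u k
    using that
  proof (induction k arbitrary: u)
    case 0
    then show ?case by (simp add: U_def)
  next
    case (Suc k)
    have "subspace {u. bracket x u \<in> U (Suc k)}"
      using sub[of "Suc k"] by (auto simp: subspace_def bracket_add_right bracket_scale_right)
    then have "commutator m (U k) \<subseteq> {u. bracket x u \<in> U (Suc k)}"
    proof (rule commutator_least)
      fix a v assume av: "a \<in> m" "v \<in> U k"
      have "bracket (bracket x a) v \<in> U (Suc k)" "bracket a (bracket x v) \<in> U (Suc k)"
        using av step norm Suc.IH by blast+
      then show "bracket a v \<in> {u. bracket x u \<in> U (Suc k)}"
        by (simp add: bracket_derivation[of x] subspace_add[OF sub])
    qed
    then show ?case using Suc.prems by (auto simp: U_def)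
  qed
  have xpow: "(bracket x ^^ j) u \<in> U k" if "u \<in> U k" for u k j
    using that by (induction j) (auto intro: xU)
  have main: "(commutator ?m' ^^ j) (U k) \<subseteq> {(bracket x ^^ j) u + v | u v. u \<in> U k \<and> v \<in> U (Suc k)}" for j k
  proof (induction j)
    case 0
    have "u \<in> {u + v | u v. u \<in> U k \<and> v \<in> U (Suc k)}" if "u \<in> U k" for u
      using that subspace_0[OF sub[of "Suc k"]] add_0_right[of u, symmetric] by blast
    then show ?case by auto
  next
    case (Suc j)
    let ?W = "\<lambda>j. {(bracket x ^^ j) u + v | u v. u \<in> U k \<and> v \<in> U (Suc k)}"
    have lin: "(bracket x ^^ j) (u + u') = (bracket x ^^ j) u + (bracket x ^^ j) u'"
      "(bracket x ^^ j) (scale c u) = scale c ((bracket x ^^ j) u)" for j u u' c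
      by (induction j) (simp_all add: bracket_add_right bracket_scale_right)
    have "subspace (?W (Suc j))"
      unfolding subspace_def
    proof (intro conjI ballI allI)
      have "0 = (bracket x ^^ Suc j) 0 + 0" using lin(2)[of "Suc j" 0 0] by simp
      then show "0 \<in> ?W (Suc j)" using subspace_0[OF sub] by blast
    next
      fix a b assume "a \<in> ?W (Suc j)" "b \<in> ?W (Suc j)"
      then obtain u v u' v' where h: "a = (bracket x ^^ Suc j) u + v" "u \<in> U k" "v \<in> U (Suc k)"
        "b = (bracket x ^^ Suc j) u' + v'" "u' \<in> U k" "v' \<in> U (Suc k)" by blast
      have "a + b = (bracket x ^^ Suc j) (u + u') + (v + v')"
        unfolding lin(1) h by (simp add: algebra_simps)
      then show "a + b \<in> ?W (Suc j)" using h subspace_add[OF sub] by blast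
    next
      fix c a assume "a \<in> ?W (Suc j)"
      then obtain u v where h: "a = (bracket x ^^ Suc j) u + v" "u \<in> U k" "v \<in> U (Suc k)" by blast
      have "scale c a = (bracket x ^^ Suc j) (scale c u) + scale c v"
        unfolding lin(2) h by (simp add: scale_right_distrib)
      then show "scale c a \<in> ?W (Suc j)" using h subspace_scale[OF sub] by blast
    qed
    then have "commutator ?m' (?W j) \<subseteq> ?W (Suc j)"
    proof (rule commutator_least)
      fix y z assume "y \<in> ?m'" "z \<in> ?W j"
      then obtain a c u v where h: "y = a + scale c x" "a \<in> m"
        "z = (bracket x ^^ j) u + v" "u \<in> U k" "v \<in> U (Suc k)" by blast
      define r where "r = bracket a ((bracket x ^^ j) u) + bracket a v + scale c (bracket x v)"
      have "bracket a ((bracket x ^^ j) u) \<in> U (Suc k)" using h(2) xpow[OF h(4)] by (rule step)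
      moreover have "bracket a v \<in> U (Suc k)" using h(2,5) step dec by blast
      moreover have "scale c (bracket x v) \<in> U (Suc k)" using xU[OF h(5)] by (rule subspace_scale[OF sub])
      ultimately have "r \<in> U (Suc k)" unfolding r_def by (intro subspace_add[OF sub])
      moreover have "bracket y z = (bracket x ^^ Suc j) (scale c u) + r"
        unfolding lin(2) by (simp add: h r_def bracket_add_left bracket_add_right bracket_scale_left scale_right_distrib)
      ultimately show "bracket y z \<in> ?W (Suc j)" using subspace_scale[OF sub h(4)] by blast
    qed
    have "(commutator ?m' ^^ Suc j) (U k) = commutator ?m' ((commutator ?m' ^^ j) (U k))" by simp
    also have "\<dots> \<subseteq> commutator ?m' (?W j)" by (rule commutator_mono[OF order_refl Suc])
    also have "\<dots> \<subseteq> ?W (Suc j)" by fact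
    finally show ?case .
  qed
  have "(commutator ?m' ^^ (M * k)) UNIV \<subseteq> U k"
  proof (induction k)
    case 0
    then show ?case by (simp add: U_def)
  next
    case (Suc k)
    have "(commutator ?m' ^^ (M * Suc k)) UNIV = (commutator ?m' ^^ M) ((commutator ?m' ^^ (M * k)) UNIV)"
      by (simp add: funpow_add)
    also have "\<dots> \<subseteq> (commutator ?m' ^^ M) (U k)" by (rule lower_series_mono[OF order_refl Suc])
    also have "\<dots> \<subseteq> U (Suc k)" using main[of M k] x by auto
    finally show ?case .
  qed
  then show ?thesis by (simp add: U_def)
qed

text \<open>
Engel's theorem for the adjoint action. A subalgebra \<open>m\<close> of maximal dimension with the desired property
is all of \<open>s\<close>: otherwise the last space of the series \<open>s, [m, s], ...\<close> that is not contained in \<open>m\<close> provides an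
element \<open>x\<close> outside \<open>m\<close> that normalizes \<open>m\<close>, and \<open>x\<close> can be adjoined.
\<close>

lemma engel:
  assumes fin: "finite F" "span F = UNIV" and s: "subalgebra s"
    and nil: "\<And>x. x \<in> s \<Longrightarrow> \<exists>k. \<forall>v. (bracket x ^^ k) v = 0"
  shows "\<exists>N. (commutator s ^^ N) UNIV = {0}"
proof -
  obtain Bs where Bs: "Bs \<subseteq> F" "independent Bs" "F \<subseteq> span Bs"
    using maximal_independent_subset[of F] by blast
  then have "span Bs = UNIV" using fin(2) span_mono[OF Bs(3)] by (auto simp: span_span)
  interpret fd: finite_dimensional_vector_space scale Bs
    using Bs \<open>span Bs = UNIV\<close> fin(1) by unfold_locales (auto intro: finite_subset)
  define good where "good m \<longleftrightarrow> subalgebra m \<and> m \<subseteq> s \<and> (\<exists>N. (commutator m ^^ N) UNIV = {0})" for m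
  have "commutator {0} UNIV = {0}"
    using commutator_least[of "{0}" "{0}" UNIV] subspace_0[OF subspace_commutator[of "{0}" UNIV]]
    by auto
  then have "(commutator {0} ^^ 1) UNIV = {0}" by simp
  moreover have "subalgebra {0}" "{0} \<subseteq> s"
    using subspace_0[OF subalgebra_subspace[OF s]] by (simp_all add: subalgebra_def)
  ultimately have "good {0}" unfolding good_def by blast
  moreover have "\<forall>m'. good m' \<longrightarrow> dim m' < Suc (card Bs)"
    using fd.dim_subset_UNIV by (simp add: less_Suc_eq_le fd.dimension_def)
  ultimately have "\<exists>m. good m \<and> (\<forall>m'. good m' \<longrightarrow> dim m' \<le> dim m)"
    by (rule ex_has_greatest_nat[where P = good and f = dim])
  then obtain m where m: "good m" and max: "\<And>m'. good m' \<Longrightarrow> dim m' \<le> dim m" by blast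
  obtain N where N: "(commutator m ^^ N) UNIV = {0}" using m by (auto simp: good_def)
  have ms: "subalgebra m" "m \<subseteq> s" using m by (auto simp: good_def)
  have "m = s"
  proof (rule ccontr)
    assume "m \<noteq> s"
    then have ns: "\<not> s \<subseteq> m" using ms by blast
    let ?L = "\<lambda>k. (commutator m ^^ k) s"
    have "?L N \<subseteq> m"
      using lower_series_mono[of m m s UNIV N] N subspace_0[OF subalgebra_subspace[OF ms(1)]] by auto
    then have "\<exists>k<N. (\<forall>i\<le>k. \<not> ?L i \<subseteq> m) \<and> ?L (Suc k) \<subseteq> m"
      using ns by (intro ex_least_nat_less[where P = "\<lambda>k. ?L k \<subseteq> m"]) auto
    then obtain k where k: "?L (Suc k) \<subseteq> m" "\<not> ?L k \<subseteq> m" by blast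
    have Ls: "?L k \<subseteq> s" for k
    proof (induction k)
      case (Suc k)
      have "commutator m (?L k) \<subseteq> s"
        using Suc s ms by (intro commutator_least) (auto simp: subalgebra_def)
      then show ?case by simp
    qed simp
    obtain x where x: "x \<in> ?L k" "x \<notin> m" using k by blast
    have norm: "bracket x a \<in> m" if "a \<in> m" for a
    proof -
      have "bracket a x \<in> m" using k(1) bracket_mem_commutator[OF that x(1)] by auto
      then show ?thesis
        using bracket_skew[of x a] subspace_neg[OF subalgebra_subspace[OF ms(1)]] by metis
    qed
    have xs: "x \<in> s" using Ls x by blast
    then obtain M where M: "\<And>v. (bracket x ^^ M) v = 0" using nil by blast
    define m' where "m' = {a + scale c x | a c. a \<in> m}"
    have sm: "subspace m" using ms by (simp add: subalgebra_def)
    have mem: "a + scale c x \<in> m'" if "a \<in> m" for a c using that by (auto simp: m'_def)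
    have sub: "subspace m'"
      unfolding subspace_def
    proof (intro conjI ballI allI)
      show "0 \<in> m'" using mem[of 0 0] subspace_0[OF sm] by simp
    next
      fix u v assume "u \<in> m'" "v \<in> m'"
      then obtain a b c d where "u = a + scale c x" "v = b + scale d x" "a \<in> m" "b \<in> m"
        by (auto simp: m'_def)
      moreover have "a + scale c x + (b + scale d x) = (a + b) + scale (c + d) x"
        by (simp add: algebra_simps scale_left_distrib)
      ultimately show "u + v \<in> m'" using subspace_add[OF sm] unfolding m'_def by blast
    next
      fix r u assume "u \<in> m'"
      then obtain a c where "u = a + scale c x" "a \<in> m" by (auto simp: m'_def)
      moreover have "scale r (a + scale c x) = scale r a + scale (r * c) x"
        by (simp add: scale_right_distrib)
      ultimately show "scale r u \<in> m'" using subspace_scale[OF sm] unfolding m'_def by blast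
    qed
    have mm': "m \<subseteq> m'" using mem[of _ 0] by auto
    have xm': "x \<in> m'" using mem[of 0 1] subspace_0[OF sm] by simp
    have "good m'" unfolding good_def
    proof (intro conjI)
      show "subalgebra m'" unfolding subalgebra_def
      proof (intro conjI ballI sub)
        fix u v assume "u \<in> m'" "v \<in> m'"
        then obtain a b c d where h: "u = a + scale c x" "v = b + scale d x" "a \<in> m" "b \<in> m"
          by (auto simp: m'_def)
        have "bracket u v = bracket a b + scale c (bracket x b) + scale d (- bracket x a)"
          unfolding h using bracket_skew[of a x]
          by (simp add: bracket_add_left bracket_add_right bracket_scale_left bracket_scale_right bracket_self algebra_simps)
        also have "\<dots> \<in> m"
          using norm[OF h(3)] norm[OF h(4)] subalgebra_bracket[OF ms(1) h(3,4)]
          by (simp add: subspace_add[OF sm] subspace_diff[OF sm] subspace_scale[OF sm])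
        finally show "bracket u v \<in> m'" using mm' by blast
      qed
      show "m' \<subseteq> s"
      proof
        fix u assume "u \<in> m'"
        then obtain a c where "u = a + scale c x" "a \<in> m" unfolding m'_def by blast
        moreover have "scale c x \<in> s" using xs subspace_scale[OF subalgebra_subspace[OF s]] by blast
        ultimately show "u \<in> s" using ms(2) subspace_add[OF subalgebra_subspace[OF s]] by blast
      qed
      have "(commutator m' ^^ (M * N)) UNIV \<subseteq> (commutator m ^^ N) UNIV"
        unfolding m'_def using norm M by (rule lower_series_adjoin[OF ms(1)])
      then have "(commutator m' ^^ (M * N)) UNIV = {0}"
        using N subspace_0[OF subspace_lower_series[OF subspace_UNIV, where m = m' and k = "M * N"]] by blast
      then show "\<exists>N. (commutator m' ^^ N) UNIV = {0}" by blast
    qed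
    then have "dim m' \<le> dim m" by (rule max)
    moreover have "dim m < dim m'"
    proof (rule fd.dim_psubset)
      show "span m \<subset> span m'"
        unfolding span_eq_iff[THEN iffD2, OF sm] span_eq_iff[THEN iffD2, OF sub]
        using mm' xm' x(2) by blast
    qed
    ultimately show False by simp
  qed
  then show ?thesis using N by blast
qed

end

section \<open>Lie algebras with a nondegenerate invariant form\<close>

text \<open>
Instead of a basis, a finite family \<open>E\<close> with a dual family \<open>w\<close>, in the sense of \<open>expansion\<close>, is fixed. It makes
\<open>B\<close> nondegenerate and lets traces be computed with \<open>B\<close>. The same formulas hold for families that are not
linearly independent, such as the projections of \<open>E\<close> and \<open>w\<close> to the two summands of a splitting.
\<close>

locale metrized_lie_algebra = lie_algebra scale bracket
  for scale :: "real \<Rightarrow> 'g::ab_group_add \<Rightarrow> 'g" and bracket :: "'g \<Rightarrow> 'g \<Rightarrow> 'g" +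
  fixes B :: "'g \<Rightarrow> 'g \<Rightarrow> real" and E :: "'g set" and w :: "'g \<Rightarrow> 'g"
  assumes B_add_left: "B (x + y) z = B x z + B y z"
    and B_scale_left: "B (scale c x) y = c * B x y"
    and B_sym: "B x y = B y x"
    and B_invariant: "B (bracket x y) z = - B y (bracket x z)"
    and finite_frame: "finite E"
    and expansion: "x = (\<Sum>e\<in>E. scale (B x (w e)) e)"
begin

lemma B_add_right: "B z (x + y) = B z x + B z y"
  unfolding B_sym[of z] by (rule B_add_left)

lemma B_scale_right: "B y (scale c x) = c * B y x"
  unfolding B_sym[of y] by (rule B_scale_left)

lemma B_zero_left [simp]: "B 0 x = 0"
  using B_add_left[of 0 0 x] by simp

lemma B_zero_right [simp]: "B x 0 = 0"
  using B_add_right[of x 0 0] by simp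

lemma B_minus_left [simp]: "B (- x) y = - B x y"
  using B_add_left[of x "- x" y] by simp

lemma B_minus_right [simp]: "B x (- y) = - B x y"
  using B_add_right[of x y "- y"] by simp

lemma B_diff_left: "B (x - y) z = B x z - B y z"
  using B_add_left[of x "- y" z] by simp

lemma B_sum_left: "B (\<Sum>e\<in>I. f e) z = (\<Sum>e\<in>I. B (f e) z)"
  by (induction I rule: infinite_finite_induct) (simp_all add: B_add_left)

lemma B_sum_right: "B z (\<Sum>e\<in>I. f e) = (\<Sum>e\<in>I. B z (f e))"
  by (induction I rule: infinite_finite_induct) (simp_all add: B_add_right)

lemma B_cyclic: "B (bracket x y) z = B x (bracket y z)"
proof -
  have "B (bracket x y) z = - B (bracket y x) z" unfolding bracket_skew[of x y] by simp
  then show ?thesis using B_invariant[of y x z] by simp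
qed

lemma nondegenerate:
  assumes "\<And>y. B x y = 0"
  shows "x = 0"
  by (rule trans[OF expansion]) (simp add: assms)

lemma eq_if_B_eq: "(\<And>y. B x y = B x' y) \<Longrightarrow> x = x'"
  using nondegenerate[of "x - x'"] by (simp add: B_diff_left)

lemma B_expand: "B x y = (\<Sum>e\<in>E. B x (w e) * B e y)"
  using arg_cong[OF expansion[of x], of "\<lambda>v. B v y"]
  by (simp only: B_sum_left B_scale_left)

text \<open>
The expansion is symmetric in the two families, since \<open>B\<close> is.
\<close>

lemma dual_expansion: "x = (\<Sum>e\<in>E. scale (B x e) (w e))"
proof (rule eq_if_B_eq)
  fix y
  show "B x y = B (\<Sum>e\<in>E. scale (B x e) (w e)) y"
    unfolding B_sum_left B_scale_left B_sym[of x y] B_expand[of y x]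
    by (rule sum.cong) (simp_all add: B_sym[of _ x] B_sym[of y] mult.commute)
qed

definition endo :: "('g \<Rightarrow> 'g) \<Rightarrow> bool" where
  "endo f \<longleftrightarrow> (\<forall>x y. f (x + y) = f x + f y) \<and> (\<forall>c x. f (scale c x) = scale c (f x))"

lemma endo_add: "endo f \<Longrightarrow> f (x + y) = f x + f y"
  and endo_scale: "endo f \<Longrightarrow> f (scale c x) = scale c (f x)"
  by (auto simp: endo_def)

lemma endo_zero: "endo f \<Longrightarrow> f 0 = 0"
  using endo_scale[of f 0 0] by simp

lemma endo_diff: "endo f \<Longrightarrow> f (x - y) = f x - f y"
  using endo_add[of f "x - y" y] by (simp add: eq_diff_eq)

lemma endo_sum:
  assumes f: "endo f"
  shows "f (\<Sum>e\<in>I. g e) = (\<Sum>e\<in>I. f (g e))"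
  by (induction I rule: infinite_finite_induct) (simp_all add: endo_add[OF f] endo_zero[OF f])

lemma endo_ident [simp]: "endo (\<lambda>x. x)"
  by (simp add: endo_def)

lemma endo_bracket [simp]: "endo (bracket x)"
  by (simp add: endo_def bracket_add_right bracket_scale_right)

lemma endo_comp: "endo f \<Longrightarrow> endo g \<Longrightarrow> endo (\<lambda>x. f (g x))"
  by (simp add: endo_def)

lemma endo_funpow: "endo f \<Longrightarrow> endo (f ^^ k)"
  by (induction k) (simp_all add: endo_def)

definition trace :: "('g \<Rightarrow> 'g) \<Rightarrow> real" where
  "trace f = (\<Sum>e\<in>E. B (f e) (w e))"

lemma trace_add: "trace (\<lambda>x. f x + g x) = trace f + trace g"
  by (simp add: trace_def B_add_left sum.distrib)

lemma trace_diff: "trace (\<lambda>x. f x - g x) = trace f - trace g"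
  by (simp add: trace_def B_diff_left sum_subtractf)

lemma trace_zero [simp]: "trace (\<lambda>x. 0) = 0"
  by (simp add: trace_def)

lemma trace_scale: "trace (\<lambda>x. scale c (f x)) = c * trace f"
  by (simp add: trace_def B_scale_left sum_distrib_left)

lemma endo_expand:
  assumes f: "endo f"
  shows "f x = (\<Sum>e\<in>E. scale (B x (w e)) (f e))"
  using arg_cong[OF expansion[of x], of f] by (simp only: endo_sum[OF f] endo_scale[OF f])

lemma B_endo_expand:
  assumes f: "endo f"
  shows "B (f x) y = (\<Sum>e\<in>E. B x (w e) * B (f e) y)"
  using arg_cong[OF endo_expand[OF f, of x], of "\<lambda>v. B v y"]
  by (simp only: B_sum_left B_scale_left)

lemma trace_comp: "endo f \<Longrightarrow> trace (\<lambda>x. f (g x)) = (\<Sum>e\<in>E. \<Sum>h\<in>E. B (g e) (w h) * B (f h) (w e))"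
  unfolding trace_def by (intro sum.cong B_endo_expand) simp_all

lemma trace_commute:
  assumes "endo f" "endo g"
  shows "trace (\<lambda>x. f (g x)) = trace (\<lambda>x. g (f x))"
  unfolding trace_comp[OF assms(1)] trace_comp[OF assms(2)]
  by (subst sum.swap) (simp add: mult.commute)

text \<open>
The trace does not depend on which of the two dual families is expanded in which.
\<close>

lemma trace_dual:
  assumes g: "endo g"
  shows "(\<Sum>e\<in>E. B (g (w e)) e) = trace g"
proof -
  have "(\<Sum>e\<in>E. B (g (w e)) e) = (\<Sum>e\<in>E. \<Sum>h\<in>E. B (w e) (w h) * B (g h) e)"
    by (intro sum.cong B_endo_expand[OF g]) simp_all
  also have "\<dots> = (\<Sum>h\<in>E. \<Sum>e\<in>E. B (w h) (w e) * B e (g h))"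
    by (subst sum.swap) (simp add: B_sym)
  also have "\<dots> = trace g"
    unfolding trace_def by (simp add: B_sym[of "g _"] flip: B_expand)
  finally show ?thesis .
qed

lemma trace_adjoint:
  assumes g: "endo g" and adj: "\<And>x y. B (f x) y = B x (g y)"
  shows "trace f = trace g"
proof -
  have "trace f = (\<Sum>e\<in>E. B (g (w e)) e)"
    unfolding trace_def adj by (intro sum.cong refl B_sym)
  then show ?thesis unfolding trace_dual[OF g] .
qed

definition enum :: "nat \<Rightarrow> 'g" where
  "enum = (SOME e. bij_betw e {..<card E} E)"

lemma bij_enum: "bij_betw enum {..<card E} E"
proof -
  have "\<exists>e. bij_betw e {..<card E} E"
    using ex_bij_betw_nat_finite[OF finite_frame] by (simp add: lessThan_atLeast0)
  then show ?thesis unfolding enum_def by (rule someI_ex)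
qed

lemma sum_enum: "(\<Sum>i<card E. g (enum i)) = (\<Sum>e\<in>E. g e)"
  by (rule sum.reindex_bij_betw[OF bij_enum])

text \<open>
Coordinates with respect to the dual families. If \<open>E\<close> is linearly dependent, the identity is not sent to
the identity matrix, but products are still respected.
\<close>

definition mat_of :: "('g \<Rightarrow> 'g) \<Rightarrow> real mat" where
  "mat_of f = mat (card E) (card E) (\<lambda>(i,j). B (f (enum j)) (w (enum i)))"

lemma mat_of_carrier [simp]: "mat_of f \<in> carrier_mat (card E) (card E)"
  by (simp add: mat_of_def)

lemma mat_of_index: "i < card E \<Longrightarrow> j < card E \<Longrightarrow> mat_of f $$ (i,j) = B (f (enum j)) (w (enum i))"
  by (simp add: mat_of_def)

lemma mat_of_dim [simp]: "dim_row (mat_of f) = card E" "dim_col (mat_of f) = card E"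
  by (simp_all add: mat_of_def)

lemma mat_trace_mat_of: "mat_trace (mat_of f) = trace f"
  by (simp add: mat_trace_def mat_of_index trace_def sum_enum[of "\<lambda>e. B (f e) (w e)"])

lemma mat_of_comp:
  assumes "endo f"
  shows "mat_of (\<lambda>x. f (g x)) = mat_of f * mat_of g"
proof (rule eq_matI)
  fix i j assume "i < dim_row (mat_of f * mat_of g)" "j < dim_col (mat_of f * mat_of g)"
  then have ij: "i < card E" "j < card E" by simp_all
  have "(mat_of f * mat_of g) $$ (i,j) =
    (\<Sum>k<card E. B (f (enum k)) (w (enum i)) * B (g (enum j)) (w (enum k)))"
    unfolding mult_mat_entry[OF mat_of_carrier mat_of_carrier ij]
    using ij by (intro sum.cong) (simp_all add: mat_of_index)
  also have "\<dots> = (\<Sum>e\<in>E. B (f e) (w (enum i)) * B (g (enum j)) (w e))"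
    by (rule sum_enum)
  also have "\<dots> = B (f (g (enum j))) (w (enum i))"
    unfolding B_endo_expand[OF assms, of "g (enum j)"] by (simp add: mult.commute)
  finally show "mat_of (\<lambda>x. f (g x)) $$ (i,j) = (mat_of f * mat_of g) $$ (i,j)"
    using ij by (simp add: mat_of_index)
qed simp_all

lemma mat_of_add: "mat_of (\<lambda>x. f x + g x) = mat_of f + mat_of g"
  by (rule eq_matI) (auto simp: mat_of_index B_add_left)

lemma mat_of_diff: "mat_of (\<lambda>x. f x - g x) = mat_of f - mat_of g"
  by (rule eq_matI) (auto simp: mat_of_index B_diff_left)

lemma mat_of_scale: "mat_of (\<lambda>x. scale c (f x)) = c \<cdot>\<^sub>m mat_of f"
  by (rule eq_matI) (auto simp: mat_of_index B_scale_left)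

lemma mat_of_zero: "mat_of (\<lambda>x. 0) = 0\<^sub>m (card E) (card E)"
  by (rule eq_matI) (auto simp: mat_of_index)

text \<open>
Only positive powers: see the remark on the identity at the definition of the matrix.
\<close>

lemma mat_of_funpow:
  assumes "endo f"
  shows "mat_of (f ^^ Suc k) = mat_of f ^\<^sub>m Suc k"
proof (induction k)
  case 0
  then show ?case by simp
next
  case (Suc k)
  have "mat_of (f ^^ Suc (Suc k)) = mat_of (\<lambda>x. (f ^^ Suc k) (f x))"
    by (simp only: funpow_Suc_right[of "Suc k"] comp_def)
  also have "\<dots> = mat_of (f ^^ Suc k) * mat_of f" by (rule mat_of_comp[OF endo_funpow[OF assms]])
  finally show ?case by (simp only: Suc pow_mat.simps(2)[of "mat_of f" "Suc k"])
qed

lemma mat_of_eq_zero: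
  assumes f: "endo f" and z: "mat_of f = 0\<^sub>m (card E) (card E)"
  shows "f x = 0"
proof -
  have "f e = 0" if e: "e \<in> E" for e
  proof -
    obtain j where j: "j < card E" "e = enum j"
      using e bij_enum by (auto simp: bij_betw_def)
    have "B (f e) (w h) = 0" if h: "h \<in> E" for h
    proof -
      obtain i where i: "i < card E" "h = enum i"
        using h bij_enum by (auto simp: bij_betw_def)
      show ?thesis using mat_of_index[OF i(1) j(1), of f] z i j by simp
    qed
    then have "(\<Sum>h\<in>E. scale (B (f e) (w h)) h) = 0" by simp
    then show ?thesis by (rule trans[OF expansion])
  qed
  then show ?thesis using endo_expand[OF f, of x] by simp
qed

lemma trace_nilpotent:
  assumes f: "endo f" and nil: "\<And>x. (f ^^ k) x = 0"
  shows "trace f = 0"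
proof -
  have "(f ^^ Suc k) = (\<lambda>x. 0)"
    using nil endo_zero[OF f] by (auto simp: fun_eq_iff)
  then have "mat_of f ^\<^sub>m Suc k = 0\<^sub>m (card E) (card E)"
    using mat_of_funpow[OF f, of k] mat_of_zero by simp
  then show ?thesis using mat_trace_nilpotent[OF mat_of_carrier] by (simp only: flip: mat_trace_mat_of)
qed

lemma nilpotent_if_mat_of_nilpotent:
  assumes f: "endo f" and nil: "mat_of f ^\<^sub>m k = 0\<^sub>m (card E) (card E)"
  shows "\<exists>k. \<forall>x. (f ^^ k) x = 0"
proof -
  have "mat_of (f ^^ Suc k) = mat_of f ^\<^sub>m Suc k" by (rule mat_of_funpow[OF f])
  also have "\<dots> = 0\<^sub>m (card E) (card E)" using nil by simp
  finally show ?thesis using mat_of_eq_zero[OF endo_funpow[OF f]] by blast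
qed

lemma nilpotent_if_traces_zero:
  assumes f: "endo f" and z: "\<And>k. trace (f ^^ Suc k) = 0"
  shows "\<exists>k. \<forall>x. (f ^^ k) x = 0"
proof (rule nilpotent_if_mat_of_nilpotent[OF f])
  show "mat_of f ^\<^sub>m card E = 0\<^sub>m (card E) (card E)"
  proof (rule nilpotent_if_power_traces_zero[OF mat_of_carrier])
    fix k :: nat assume "1 \<le> k"
    then obtain l where l: "k = Suc l" by (cases k) auto
    have "mat_trace (mat_of f ^\<^sub>m Suc l) = trace (f ^^ Suc l)"
      using mat_of_funpow[OF f, of l] mat_trace_mat_of[of "f ^^ Suc l"] by (simp only:)
    then show "mat_trace (mat_of f ^\<^sub>m k) = 0" using z l by simp
  qed
qed

lemma span_frame: "span E = UNIV"
proof -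
  have "x \<in> span E" for x
    by (subst expansion[of x]) (intro span_sum span_scale span_base)
  then show ?thesis by blast
qed

definition killing :: "'g \<Rightarrow> 'g \<Rightarrow> real" where
  "killing x y = trace (\<lambda>v. bracket x (bracket y v))"

lemma killing_commute: "killing x y = killing y x"
  unfolding killing_def using trace_commute[of "bracket x" "bracket y"] by simp

lemma killing_add_left: "killing (x + y) z = killing x z + killing y z"
  by (simp add: killing_def bracket_add_left trace_add)

lemma killing_scale_left: "killing (scale c x) z = c * killing x z"
  by (simp add: killing_def bracket_scale_left trace_scale)

lemma killing_invariant: "killing (bracket x y) z = killing x (bracket y z)"
proof -
  have "trace (\<lambda>v. bracket y (bracket x (bracket z v))) = trace (\<lambda>v. bracket x (bracket z (bracket y v)))"
    using trace_commute[of "bracket y" "\<lambda>v. bracket x (bracket z v)"]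
    by (simp add: endo_comp[OF endo_bracket endo_bracket])
  then show ?thesis
    unfolding killing_def bracket_bracket bracket_diff_right trace_diff by simp
qed

text \<open>
The matrix criterion applied to the complexification of \<open>ad s\<close>; the form \<open>x, y \<mapsto> tr (ad x ad y)\<close> on \<open>s\<close> is
taken on the whole algebra.
\<close>

lemma ad_nilpotent_if_killing_zero:
  assumes s: "subalgebra s" and K: "\<And>x y. x \<in> s \<Longrightarrow> y \<in> s \<Longrightarrow> killing x y = 0"
    and z: "z \<in> commutator s s"
  shows "\<exists>k. \<forall>v. (bracket z ^^ k) v = 0"
proof -
  define n where "n = card E"
  define M where "M x = map_mat complex_of_real (mat_of (bracket x))" for x
  have M: "M x \<in> carrier_mat n n" for x by (simp add: M_def n_def)
  have M_add: "M (x + y) = M x + M y" for x y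
  proof -
    have "bracket (x + y) = (\<lambda>v. bracket x v + bracket y v)"
      by (simp add: fun_eq_iff bracket_add_left)
    then show ?thesis unfolding M_def by (intro eq_matI) (simp_all add: mat_of_add)
  qed
  have M_scale: "M (scale c x) = complex_of_real c \<cdot>\<^sub>m M x" for c x
  proof -
    have "bracket (scale c x) = (\<lambda>v. scale c (bracket x v))"
      by (simp add: fun_eq_iff bracket_scale_left)
    then show ?thesis unfolding M_def by (intro eq_matI) (simp_all add: mat_of_scale)
  qed
  have M_zero: "M 0 = 0\<^sub>m n n"
  proof -
    have "bracket 0 = (\<lambda>v. 0)" by (simp add: fun_eq_iff)
    then show ?thesis unfolding M_def n_def by (intro eq_matI) (simp_all add: mat_of_zero)
  qed
  have M_mult: "map_mat complex_of_real (mat_of (\<lambda>v. bracket x (bracket y v))) = M x * M y" for x y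
    unfolding M_def mat_of_comp[OF endo_bracket, of x "bracket y"]
    by (rule of_real_hom.mat_hom_mult[OF mat_of_carrier mat_of_carrier])
  have M_bracket: "M (bracket x y) = M x * M y - M y * M x" for x y
  proof -
    have "bracket (bracket x y) = (\<lambda>v. bracket x (bracket y v) - bracket y (bracket x v))"
      by (simp add: fun_eq_iff bracket_bracket)
    then have "M (bracket x y) = map_mat complex_of_real
      (mat_of (\<lambda>v. bracket x (bracket y v)) - mat_of (\<lambda>v. bracket y (bracket x v)))"
      by (simp add: M_def mat_of_diff)
    also have "\<dots> = M x * M y - M y * M x"
      unfolding M_mult[symmetric] by (rule eq_matI) simp_all
    finally show ?thesis .
  qed
  have M_tr: "mat_trace (M x * M y) = complex_of_real (killing x y)" for x y
    unfolding M_mult[symmetric] mat_trace_of_real[OF mat_of_carrier] mat_trace_mat_of killing_def ..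
  note sub = subalgebra_subspace[OF s]
  note dist = minus_mult_distrib_mat[of _ n n _ _ n] mult_minus_distrib_mat[of _ n n _ n]
    add_mult_distrib_mat[of _ n n _ _ n] mult_add_distrib_mat[of _ n n _ n]
    mult_smult_distrib[of _ n n _ n] mult_smult_assoc_mat[of _ n n _ n]
  \<comment> \<open>the complexification of \<open>s\<close>\<close>
  define S where "S = {M x + \<i> \<cdot>\<^sub>m M y | x y. x \<in> s \<and> y \<in> s}"
  have MS: "M x \<in> S" if "x \<in> s" for x
  proof -
    have "M x = M x + \<i> \<cdot>\<^sub>m M 0" using M[of x] unfolding M_zero by (intro eq_matI) auto
    then show ?thesis using that subspace_0[OF sub] unfolding S_def by blast
  qed
  have "commutator s s \<subseteq> s" by (rule commutator_least[OF sub]) (rule subalgebra_bracket[OF s])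
  then have zs: "z \<in> s" using z by blast
  have "M z ^\<^sub>m n = 0\<^sub>m n n"
  proof (rule nilpotent_if_trace_form_zero[OF M])
    show "S \<subseteq> carrier_mat n n" using M by (auto simp: S_def)
    show "0\<^sub>m n n \<in> S" using MS[OF subspace_0[OF sub]] by (simp add: M_zero)
  next
    fix X Y assume "X \<in> S" "Y \<in> S"
    then obtain x x' y y' where h: "X = M x + \<i> \<cdot>\<^sub>m M x'" "Y = M y + \<i> \<cdot>\<^sub>m M y'"
      "x \<in> s" "x' \<in> s" "y \<in> s" "y' \<in> s" unfolding S_def by blast
    have "X + Y = M (x + y) + \<i> \<cdot>\<^sub>m M (x' + y')"
      unfolding h M_add using M[of x] M[of x'] M[of y] M[of y']
      by (intro eq_matI) (auto simp: algebra_simps)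
    then show "X + Y \<in> S" using h subspace_add[OF sub] unfolding S_def by blast
    show "mat_trace (X * Y) = 0"
      unfolding h using M[of x] M[of x'] M[of y] M[of y'] h K
      by (simp add: dist mat_trace_add[of _ n] mat_trace_smult[of _ n] M_tr)
  next
    fix c X assume "X \<in> S"
    then obtain x x' where h: "X = M x + \<i> \<cdot>\<^sub>m M x'" "x \<in> s" "x' \<in> s" unfolding S_def by blast
    have "c \<cdot>\<^sub>m X = M (scale (Re c) x - scale (Im c) x') + \<i> \<cdot>\<^sub>m M (scale (Im c) x + scale (Re c) x')"
      unfolding h diff_conv_add_uminus scale_minus_left[symmetric] M_add M_scale using M[of x] M[of x']
      by (intro eq_matI) (auto simp: complex_eq_iff algebra_simps)
    then show "c \<cdot>\<^sub>m X \<in> S"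
      using h subspace_add[OF sub] subspace_diff[OF sub] subspace_scale[OF sub] unfolding S_def by blast
  next
    fix X assume "X \<in> S"
    then obtain x x' where h: "X = M x + \<i> \<cdot>\<^sub>m M x'" "x \<in> s" "x' \<in> s" unfolding S_def by blast
    have "M z * X - X * M z = M (bracket z x) + \<i> \<cdot>\<^sub>m M (bracket z x')"
      unfolding h M_bracket using M[of x] M[of x'] M[of z]
      by (simp add: dist) (intro eq_matI; simp add: algebra_simps)
    then show "M z * X - X * M z \<in> S"
      using h zs subalgebra_bracket[OF s] unfolding S_def by blast
  next
    fix W :: "complex mat" assume W: "W \<in> carrier_mat n n"
      and br: "\<And>X Y. X \<in> S \<Longrightarrow> Y \<in> S \<Longrightarrow> mat_trace (W * (X * Y - Y * X)) = 0"
    have "subspace {u. mat_trace (W * M u) = 0}"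
      unfolding subspace_def using W M
      by (auto simp: M_add M_scale M_zero dist mat_trace_add[of _ n] mat_trace_smult[of _ n])
    then have "commutator s s \<subseteq> {u. mat_trace (W * M u) = 0}"
      by (rule commutator_least) (use br MS in \<open>auto simp: M_bracket\<close>)
    then show "mat_trace (W * M z) = 0" using z by blast
  qed
  then have "mat_of (bracket z) ^\<^sub>m n = 0\<^sub>m n n"
    unfolding M_def n_def using of_real_mat_eq_0[of "mat_of (bracket z) ^\<^sub>m card E" "card E"]
    by (simp add: of_real_mat_pow[OF mat_of_carrier])
  then show ?thesis unfolding n_def by (rule nilpotent_if_mat_of_nilpotent[OF endo_bracket])
qed

lemma solvable_if_ad_nilpotent:
  assumes "subalgebra s" "\<And>x. x \<in> s \<Longrightarrow> \<exists>k. \<forall>v. (bracket x ^^ k) v = 0"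
  shows "solvable s"
  using engel[OF finite_frame span_frame assms] solvable_if_lower_series[OF assms(1)] by blast

text \<open>
Derived elements are \<open>ad\<close>-nilpotent, so the derived algebra is solvable by Engel's theorem.
\<close>

lemma cartan_criterion:
  assumes s: "subalgebra s" and K: "\<And>x y. x \<in> s \<Longrightarrow> y \<in> s \<Longrightarrow> killing x y = 0"
  shows "solvable s"
proof (rule derived_series_solvable, rule solvable_if_ad_nilpotent)
  show "subalgebra (commutator s s)" by (rule subalgebra_commutator[OF s])
  show "\<exists>k. \<forall>v. (bracket x ^^ k) v = 0" if "x \<in> commutator s s" for x
    using ad_nilpotent_if_killing_zero[OF s _ that] K by blast
qed

end

section \<open>Nilpotent action in every representation\<close>

lemma mat_eq_if_diff_zero:
  fixes X Y :: "'a::ab_group_add mat"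
  assumes "X \<in> carrier_mat n n" "Y \<in> carrier_mat n n" "X - Y = 0\<^sub>m n n"
  shows "X = Y"
proof (rule eq_matI)
  fix i j assume "i < dim_row Y" "j < dim_col Y"
  then have ij: "i < n" "j < n" using assms by auto
  then have "(X - Y) $$ (i,j) = 0" using assms(3) by simp
  then show "X $$ (i,j) = Y $$ (i,j)" using ij assms(1,2) by simp
qed (use assms in auto)

lemma commuting_product_power:
  fixes C H :: "'a::semiring_1 mat"
  assumes C: "C \<in> carrier_mat n n" and H: "H \<in> carrier_mat n n" and CH: "C * H = H * C"
  shows "(C * H) ^\<^sub>m k = C ^\<^sub>m k * H ^\<^sub>m k"
proof (induction k)
  case 0
  then show ?case using C H by simp
next
  case (Suc k)
  note asc = assoc_mult_mat[of _ n n _ n _ n] mult_carrier_mat[of _ n n _ n]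
  have Ck: "C ^\<^sub>m k \<in> carrier_mat n n" and Hk: "H ^\<^sub>m k \<in> carrier_mat n n" using C H by simp_all
  have comm: "H ^\<^sub>m j * C = C * H ^\<^sub>m j" for j
  proof (induction j)
    case 0
    then show ?case using C H by simp
  next
    case (Suc j)
    have Hj: "H ^\<^sub>m j \<in> carrier_mat n n" using H by simp
    have "H ^\<^sub>m Suc j * C = H ^\<^sub>m j * (C * H)" using C H Hj CH by (simp add: asc)
    also have "\<dots> = (H ^\<^sub>m j * C) * H" using C H Hj by (simp add: asc)
    also have "\<dots> = C * H ^\<^sub>m Suc j" unfolding Suc using C H Hj by (simp add: asc)
    finally show ?case .
  qed
  have "(C * H) ^\<^sub>m Suc k = C ^\<^sub>m k * ((H ^\<^sub>m k * C) * H)"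
    using C H Ck Hk Suc by (simp add: asc)
  also have "\<dots> = C ^\<^sub>m Suc k * H ^\<^sub>m Suc k"
    unfolding comm using C H Ck Hk by (simp add: asc)
  finally show ?case .
qed

context
  fixes scale :: "real \<Rightarrow> 'g::ab_group_add \<Rightarrow> 'g" and bracket :: "'g \<Rightarrow> 'g \<Rightarrow> 'g"
  assumes lie: "lie_algebra scale bracket"
begin

interpretation lie_algebra scale bracket by (fact lie)

text \<open>
Let \<open>z = \<Sum> [x, y]\<close> and let \<open>\<rho>\<close> be a representation. Then \<open>tr \<rho>(z)\<^sup>k\<^sup>+\<^sup>1\<close> is the sum of the
\<open>tr (\<rho>(x) [\<rho>(y), \<rho>(z)\<^sup>k])\<close>. If \<open>[y, z]\<close> is central and acts nilpotently, then \<open>[\<rho>(y), \<rho>(z)\<^sup>k]\<close> is a multiple of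
the nilpotent matrix \<open>\<rho>([y, z])\<close>, which commutes with everything in sight, and these traces vanish. So all
powers of \<open>\<rho>(z)\<close> have trace zero. This trace argument replaces Lie's theorem and composition series.
\<close>

lemma acts_nilpotently_if_sum_of_brackets:
  assumes A: "subalgebra A" and n: "n \<subseteq> A" "\<And>x. x \<in> n \<Longrightarrow> acts_nilpotently A x"
    and cen: "\<And>x y. x \<in> n \<Longrightarrow> y \<in> A \<Longrightarrow> bracket x y = 0"
    and z: "z \<in> span {bracket x y | x y. x \<in> A \<and> y \<in> A \<and> bracket y z \<in> n}"
  shows "acts_nilpotently A z"
  unfolding acts_nilpotently_def
proof (intro allI impI)
  fix d and \<rho> :: "'g \<Rightarrow> real mat"
  assume rep: "lie_representation A d \<rho>"
  note asc = assoc_mult_mat[of _ d d _ d _ d] mult_carrier_mat[of _ d d _ d]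
  note dist = minus_mult_distrib_mat[of _ d d _ _ d] mult_minus_distrib_mat[of _ d d _ d]
    add_mult_distrib_mat[of _ d d _ _ d] mult_add_distrib_mat[of _ d d _ d]
  have sub: "subspace A" using A by (simp add: subalgebra_def)
  have car: "\<rho> x \<in> carrier_mat d d" if "x \<in> A" for x
    using rep that by (simp add: lie_representation_def)
  have \<rho>_add: "\<rho> (x + y) = \<rho> x + \<rho> y" if "x \<in> A" "y \<in> A" for x y
    using rep that by (simp add: lie_representation_def)
  have \<rho>_scale: "\<rho> (scale c x) = c \<cdot>\<^sub>m \<rho> x" if "x \<in> A" for c x
    using rep that by (simp add: lie_representation_def)
  have \<rho>_bracket: "\<rho> (bracket x y) = \<rho> x * \<rho> y - \<rho> y * \<rho> x" if "x \<in> A" "y \<in> A" for x y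
    using rep that by (simp add: lie_representation_def)
  have \<rho>_zero: "\<rho> 0 = 0\<^sub>m d d"
  proof -
    have "\<rho> 0 = 0 \<cdot>\<^sub>m \<rho> 0" using \<rho>_scale[of 0 0] subspace_0[OF sub] by simp
    also have "\<dots> = 0\<^sub>m d d" using car[OF subspace_0[OF sub]] by (intro eq_matI) auto
    finally show ?thesis .
  qed
  have "{bracket x y | x y. x \<in> A \<and> y \<in> A \<and> bracket y z \<in> n} \<subseteq> A"
    using subalgebra_bracket[OF A] by blast
  then have zA: "z \<in> A" using z span_minimal[OF _ sub] by blast
  define R where "R = \<rho> z"
  have R: "R \<in> carrier_mat d d" and Rk: "R ^\<^sub>m k \<in> carrier_mat d d" for k
    using car[OF zA] by (simp_all add: R_def)
  have commutes: "\<rho> c * \<rho> x = \<rho> x * \<rho> c" if "c \<in> n" "x \<in> A" for c x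
  proof (rule mat_eq_if_diff_zero)
    show "\<rho> c * \<rho> x - \<rho> x * \<rho> c = 0\<^sub>m d d"
      using \<rho>_bracket[of c x] cen[OF that] \<rho>_zero that n(1) by auto
    show "\<rho> c * \<rho> x \<in> carrier_mat d d" "\<rho> x * \<rho> c \<in> carrier_mat d d"
      using car that n(1) by (auto intro!: mult_carrier_mat)
  qed
  \<comment> \<open>\<open>[\<rho>(y), \<rho>(z)\<^sup>k]\<close> is a multiple of \<open>\<rho>([y, z])\<close>, by the Leibniz rule; the cofactor \<open>G\<close> is
    essentially \<open>k \<rho>(z)\<^sup>k\<^sup>-\<^sup>1\<close>\<close>
  have power: "\<exists>G \<in> carrier_mat d d. \<rho> y * R ^\<^sub>m k - R ^\<^sub>m k * \<rho> y = \<rho> (bracket y z) * G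
      \<and> \<rho> (bracket y z) * G = G * \<rho> (bracket y z)"
    if y: "y \<in> A" and c: "bracket y z \<in> n" for y k
  proof (induction k)
    case 0
    have "\<rho> y * R ^\<^sub>m 0 - R ^\<^sub>m 0 * \<rho> y = \<rho> (bracket y z) * 0\<^sub>m d d"
      using car[OF y] car[of "bracket y z"] c n(1) R by auto
    moreover have "\<rho> (bracket y z) * 0\<^sub>m d d = 0\<^sub>m d d * \<rho> (bracket y z)"
      using car[of "bracket y z"] c n(1) by auto
    ultimately show ?case by (intro bexI[of _ "0\<^sub>m d d"]) auto
  next
    case (Suc k)
    let ?C = "\<rho> (bracket y z)" and ?Y = "\<rho> y"
    have C: "?C \<in> carrier_mat d d" using car c n(1) by blast
    have Y: "?Y \<in> carrier_mat d d" by (rule car[OF y])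
    obtain G where G: "G \<in> carrier_mat d d" "?Y * R ^\<^sub>m k - R ^\<^sub>m k * ?Y = ?C * G" "?C * G = G * ?C"
      using Suc by blast
    have CR: "?C * R = R * ?C" unfolding R_def by (rule commutes[OF c zA])
    have CRk: "?C * R ^\<^sub>m j = R ^\<^sub>m j * ?C" for j
    proof (induction j)
      case 0
      then show ?case using C R by simp
    next
      case (Suc j)
      have "?C * R ^\<^sub>m Suc j = (?C * R ^\<^sub>m j) * R" using C R Rk[of j] by (simp add: asc)
      also have "\<dots> = R ^\<^sub>m j * (?C * R)" unfolding Suc using C R Rk[of j] by (simp add: asc)
      also have "\<dots> = R ^\<^sub>m Suc j * ?C" unfolding CR using C R Rk[of j] by (simp add: asc)
      finally show ?case .
    qed
    have YR: "?Y * R - R * ?Y = ?C" unfolding R_def using \<rho>_bracket[OF y zA] by simp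
    have "?Y * R ^\<^sub>m Suc k - R ^\<^sub>m Suc k * ?Y =
      (?Y * R ^\<^sub>m k - R ^\<^sub>m k * ?Y) * R + R ^\<^sub>m k * (?Y * R - R * ?Y)"
    proof -
      have "X - Z = (X - V) + (V - Z)"
        if "X \<in> carrier_mat d d" "Z \<in> carrier_mat d d" "V \<in> carrier_mat d d" for X Z V :: "real mat"
        using that by (intro eq_matI) auto
      from this[of "?Y * R ^\<^sub>m k * R" "R ^\<^sub>m k * R * ?Y" "R ^\<^sub>m k * ?Y * R"]
      show ?thesis using Y R Rk[of k] by (simp add: dist asc)
    qed
    also have "\<dots> = ?C * (G * R + R ^\<^sub>m k)"
      unfolding G(2) YR CRk[symmetric] using C G(1) R Rk[of k] by (simp add: dist asc)
    finally have eq: "?Y * R ^\<^sub>m Suc k - R ^\<^sub>m Suc k * ?Y = ?C * (G * R + R ^\<^sub>m k)" .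
    have "?C * (G * R + R ^\<^sub>m k) = (?C * G) * R + ?C * R ^\<^sub>m k"
      using C G(1) R Rk[of k] by (simp add: dist asc)
    also have "\<dots> = G * (?C * R) + R ^\<^sub>m k * ?C"
      unfolding G(3) CRk using C G(1) R Rk[of k] by (simp add: asc)
    also have "\<dots> = (G * R + R ^\<^sub>m k) * ?C"
      unfolding CR using C G(1) R Rk[of k] by (simp add: dist asc)
    finally show ?case using eq G(1) R Rk[of k] by (intro bexI[of _ "G * R + R ^\<^sub>m k"]) auto
  qed
  have gen: "mat_trace (\<rho> (bracket x y) * R ^\<^sub>m k) = 0"
    if x: "x \<in> A" and y: "y \<in> A" and c: "bracket y z \<in> n" for x y k
  proof -
    let ?C = "\<rho> (bracket y z)" and ?Y = "\<rho> y" and ?X = "\<rho> x"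
    have C: "?C \<in> carrier_mat d d" using car c n(1) by blast
    note XY = car[OF x] car[OF y]
    obtain G where G: "G \<in> carrier_mat d d" "?Y * R ^\<^sub>m k - R ^\<^sub>m k * ?Y = ?C * G" "?C * G = G * ?C"
      using power[OF y c, of k] by blast
    have H: "?X * G \<in> carrier_mat d d" using XY G(1) by simp
    have "mat_trace (\<rho> (bracket x y) * R ^\<^sub>m k) = mat_trace (?X * (?Y * R ^\<^sub>m k)) - mat_trace (?Y * (?X * R ^\<^sub>m k))"
      unfolding \<rho>_bracket[OF x y] using XY Rk[of k] by (simp add: dist asc mat_trace_minus[of _ d])
    also have "mat_trace (?Y * (?X * R ^\<^sub>m k)) = mat_trace (?X * R ^\<^sub>m k * ?Y)"
      using XY Rk[of k] by (intro mat_trace_mult_comm[of _ d]) auto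
    also have "mat_trace (?X * (?Y * R ^\<^sub>m k)) - mat_trace (?X * R ^\<^sub>m k * ?Y) =
      mat_trace (?X * (?Y * R ^\<^sub>m k - R ^\<^sub>m k * ?Y))"
      using XY Rk[of k] by (simp add: dist asc mat_trace_minus[of _ d])
    also have "?X * (?Y * R ^\<^sub>m k - R ^\<^sub>m k * ?Y) = (?X * ?C) * G"
      unfolding G(2) using XY C G(1) by (simp add: asc)
    also have "\<dots> = ?C * (?X * G)"
      unfolding commutes[OF c x, symmetric] using XY C G(1) by (simp add: asc)
    also have "mat_trace \<dots> = 0"
    proof -
      have "?C * (?X * G) = (?X * ?C) * G"
        unfolding commutes[OF c x, symmetric] using XY C G(1) by (simp add: asc)
      also have "\<dots> = (?X * G) * ?C" using XY C G(1,3) by (simp add: asc)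
      finally have comm: "?C * (?X * G) = (?X * G) * ?C" .
      obtain j where j: "?C ^\<^sub>m j = 0\<^sub>m d d"
        using n(2)[OF c] rep unfolding acts_nilpotently_def by blast
      have Hj: "(?X * G) ^\<^sub>m j \<in> carrier_mat d d" using H by simp
      have "(?C * (?X * G)) ^\<^sub>m j = 0\<^sub>m d d * (?X * G) ^\<^sub>m j"
        unfolding commuting_product_power[OF C H comm] j ..
      also have "\<dots> = 0\<^sub>m d d" using Hj by (rule left_mult_zero_mat)
      finally show ?thesis using mat_trace_nilpotent[of "?C * (?X * G)" d j] C H by simp
    qed
    finally show ?thesis .
  qed
  have "mat_trace (R ^\<^sub>m Suc k) = 0" for k
  proof -
    let ?U = "{u \<in> A. mat_trace (\<rho> u * R ^\<^sub>m k) = 0}"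
    have "subspace ?U"
      unfolding subspace_def
      using subspace_0[OF sub] subspace_add[OF sub] subspace_scale[OF sub] Rk[of k] car
      by (auto simp: \<rho>_add \<rho>_scale \<rho>_zero mat_trace_add[of _ d] mat_trace_smult[of _ d]
          mult_smult_assoc_mat[of _ d d _ d] add_mult_distrib_mat[of _ d d _ _ d]
          mult_carrier_mat[of _ d d _ d] left_mult_zero_mat[OF Rk])
    then have "span {bracket x y | x y. x \<in> A \<and> y \<in> A \<and> bracket y z \<in> n} \<subseteq> ?U"
      by (rule span_minimal[rotated]) (use gen subalgebra_bracket[OF A] in auto)
    then have "mat_trace (R * R ^\<^sub>m k) = 0" using z unfolding R_def by blast
    then show ?thesis using mat_trace_mult_comm[OF R Rk[of k]] by simp
  qed
  then have "R ^\<^sub>m d = 0\<^sub>m d d"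
    using nilpotent_if_power_traces_zero[OF R] by (metis Suc_pred less_eq_Suc_le One_nat_def)
  then show "\<exists>k. \<rho> z ^\<^sub>m k = 0\<^sub>m d d" unfolding R_def by blast
qed

context
  fixes A n :: "'g set"
  assumes A: "subalgebra A" and rad: "is_nilpotent_radical n A"
    and cen: "\<And>x y. x \<in> n \<Longrightarrow> y \<in> A \<Longrightarrow> bracket x y = 0"
begin

lemma radical_subset: "n \<subseteq> A" and radical_nilpotent: "x \<in> n \<Longrightarrow> acts_nilpotently A x"
  and radical_ideal: "ideal_of n A"
  using rad by (auto simp: is_nilpotent_radical_def nilpotent_ideal_of_def ideal_of_def)

text \<open>
The trace argument shows that such an ideal acts nilpotently, and \<open>n\<close> is the largest ideal that does.
\<close>

lemma ideal_subset_radical: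
  assumes "ideal_of b A" and "\<And>z. z \<in> b \<Longrightarrow>
    z \<in> span {bracket x y | x y. x \<in> A \<and> y \<in> A \<and> bracket y z \<in> n}"
  shows "b \<subseteq> n"
proof -
  have "acts_nilpotently A z" if "z \<in> b" for z
    using acts_nilpotently_if_sum_of_brackets[OF A radical_subset radical_nilpotent cen] assms(2)[OF that]
    by blast
  then show ?thesis
    using assms(1) rad by (auto simp: is_nilpotent_radical_def nilpotent_ideal_of_def)
qed

lemma commutator_subset_radical:
  assumes b: "ideal_of b A" and bb: "commutator b b \<subseteq> n"
  shows "commutator A b \<subseteq> n"
proof (rule ideal_subset_radical)
  show "ideal_of (commutator A b) A" by (rule ideal_commutator[OF A ideal_self[OF A] b])
  fix z assume z: "z \<in> commutator A b"
  have zb: "z \<in> b"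
    using z commutator_least[OF ideal_subspace[OF b], of A b] ideal_bracket[OF b] by blast
  have "{bracket x y | x y. x \<in> A \<and> y \<in> b} \<subseteq> {bracket x y | x y. x \<in> A \<and> y \<in> A \<and> bracket y z \<in> n}"
    using zb bb bracket_mem_commutator[of _ b z b] ideal_subset[OF b] by blast
  then show "z \<in> span {bracket x y | x y. x \<in> A \<and> y \<in> A \<and> bracket y z \<in> n}"
    using z span_mono unfolding commutator_def by blast
qed

text \<open>
In general \<open>[A, rad A]\<close> is the nilpotent radical of \<open>A\<close>. If the nilpotent radical is central, there is a direct
descent along the derived series: a term \<open>b\<close> with \<open>[b, b] \<subseteq> n\<close> satisfies \<open>[A, b] \<subseteq> n\<close>, and if \<open>b\<close> is itself
spanned by brackets, then \<open>b \<subseteq> n\<close>.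
\<close>

lemma commutator_solvable_subset_radical:
  assumes b: "ideal_of b A" and "solvable b"
  shows "commutator A b \<subseteq> n"
proof -
  let ?D = "\<lambda>k. ((\<lambda>a. commutator a a) ^^ k) b"
  have id: "ideal_of (?D k) A" for k by (rule ideal_derived_series[OF A b])
  have desc: "?D (Suc k) \<subseteq> n \<Longrightarrow> ?D 1 \<subseteq> n" for k
  proof (induction k)
    case 0
    then show ?case by simp
  next
    case (Suc k)
    have "commutator A (?D (Suc k)) \<subseteq> n"
      using commutator_subset_radical[OF id[of "Suc k"]] Suc.prems by simp
    then have br: "bracket y z \<in> n" if "y \<in> A" "z \<in> ?D (Suc k)" for y z
      using bracket_mem_commutator[OF that] by blast
    have "?D (Suc k) \<subseteq> n"
    proof (rule ideal_subset_radical[OF id])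
      fix z assume z: "z \<in> ?D (Suc k)"
      have "{bracket x y | x y. x \<in> ?D k \<and> y \<in> ?D k} \<subseteq> {bracket x y | x y. x \<in> A \<and> y \<in> A \<and> bracket y z \<in> n}"
        using br[OF _ z] ideal_subset[OF id[of k]] by blast
      moreover have "z \<in> span {bracket x y | x y. x \<in> ?D k \<and> y \<in> ?D k}"
        using z by (simp add: commutator_def)
      ultimately show "z \<in> span {bracket x y | x y. x \<in> A \<and> y \<in> A \<and> bracket y z \<in> n}"
        using span_mono by blast
    qed
    then show ?case by (rule Suc.IH)
  qed
  obtain k where "?D k = {0}" using assms(2) by (auto simp: solvable_def)
  then have "?D (Suc k) \<subseteq> {0}" using commutator_least[of "{0}" "{0}" "{0}"] by auto
  also have "{0} \<subseteq> n" using subspace_0[OF ideal_subspace[OF radical_ideal]] by simp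
  finally have "?D 1 \<subseteq> n" by (rule desc)
  then show ?thesis using commutator_subset_radical[OF b] by simp
qed

end

end

section \<open>Splittings into isotropic subalgebras and the strange formula\<close>

text \<open>
The algebraic data of a Manin triple, over the reals.
\<close>

locale lagrangian_splitting = metrized_lie_algebra scale bracket B E w
  for scale :: "real \<Rightarrow> 'g::ab_group_add \<Rightarrow> 'g" and bracket B E w +
  fixes A A' :: "'g set"
  assumes A: "subalgebra A" and A': "subalgebra A'"
    and isotropic: "\<And>x y. x \<in> A \<Longrightarrow> y \<in> A \<Longrightarrow> B x y = 0"
    and isotropic': "\<And>x y. x \<in> A' \<Longrightarrow> y \<in> A' \<Longrightarrow> B x y = 0"
    and split: "direct_sum_decomposition A A'"
begin

lemma A_sub: "subspace A" and A'_sub: "subspace A'"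
  using A A' by (simp_all add: subalgebra_def)

definition P :: "'g \<Rightarrow> 'g" where "P x = (THE u. u \<in> A \<and> x - u \<in> A')"

definition Q :: "'g \<Rightarrow> 'g" where "Q x = x - P x"

lemma P_unique: "u \<in> A \<Longrightarrow> x - u \<in> A' \<Longrightarrow> P x = u"
  unfolding P_def
proof (rule the_equality)
  fix v assume u: "u \<in> A" "x - u \<in> A'" and v: "v \<in> A \<and> x - v \<in> A'"
  have "v - u \<in> A" using u v subspace_diff[OF A_sub] by blast
  moreover have "(x - u) - (x - v) \<in> A'" using u v subspace_diff[OF A'_sub] by blast
  then have "v - u \<in> A'" by simp
  ultimately have "v - u = 0" using split unfolding direct_sum_decomposition_def by blast
  then show "v = u" by simp
qed simp

lemma P_in: "P x \<in> A" and Q_in: "Q x \<in> A'"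
proof -
  obtain u v where "u \<in> A" "v \<in> A'" "x = u + v"
    using split unfolding direct_sum_decomposition_def by blast
  then have "u \<in> A" "x - u \<in> A'" by simp_all
  then show "P x \<in> A" "Q x \<in> A'" using P_unique unfolding Q_def by auto
qed

lemma P_id: "x \<in> A \<Longrightarrow> P x = x"
  using subspace_0[OF A'_sub] by (intro P_unique) simp_all

lemma Q_id: "x \<in> A' \<Longrightarrow> Q x = x"
  using P_unique[of 0 x] subspace_0[OF A_sub] by (simp add: Q_def)

lemma P_plus_Q: "P x + Q x = x"
  by (simp add: Q_def)

lemma P_add: "P (x + y) = P x + P y"
proof (rule P_unique)
  show "P x + P y \<in> A" by (intro subspace_add[OF A_sub] P_in)
  have "Q x + Q y \<in> A'" by (intro subspace_add[OF A'_sub] Q_in)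
  then show "x + y - (P x + P y) \<in> A'" by (simp add: Q_def algebra_simps)
qed

lemma P_scale: "P (scale c x) = scale c (P x)"
proof (rule P_unique)
  show "scale c (P x) \<in> A" by (intro subspace_scale[OF A_sub] P_in)
  have "scale c (Q x) \<in> A'" by (intro subspace_scale[OF A'_sub] Q_in)
  then show "scale c x - scale c (P x) \<in> A'" by (simp add: Q_def scale_right_diff_distrib)
qed

lemma endo_P: "endo P"
  by (simp add: endo_def P_add P_scale)

lemma endo_Q: "endo Q"
  by (simp add: endo_def Q_def P_add P_scale scale_right_diff_distrib)

lemma P_adjoint: "B (P x) y = B x (Q y)"
proof -
  have "B (P x) y = B (P x) (P y) + B (P x) (Q y)"
    by (simp add: P_plus_Q flip: B_add_right)
  moreover have "B x (Q y) = B (P x) (Q y) + B (Q x) (Q y)"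
    by (simp add: P_plus_Q flip: B_add_left)
  ultimately show ?thesis using isotropic[OF P_in P_in] isotropic'[OF Q_in Q_in] by simp
qed

lemma Q_adjoint: "B (Q x) y = B x (P y)"
  using P_adjoint[of y x] by (simp add: B_sym)

lemma trace_P:
  assumes f: "endo f"
  shows "trace f = trace (\<lambda>v. f (P v)) + trace (\<lambda>v. f (Q v))"
  by (simp add: P_plus_Q flip: trace_add endo_add[OF f])

text \<open>
The two summands play symmetric roles, so that results on \<open>A\<close> can be transferred to \<open>A'\<close>.
\<close>

lemma swap: "lagrangian_splitting scale bracket B E w A' A"
proof unfold_locales
  show "direct_sum_decomposition A' A"
    unfolding direct_sum_decomposition_def
  proof (intro conjI allI)
    show "A' \<inter> A = {0}" using split by (auto simp: direct_sum_decomposition_def)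
    fix x
    show "\<exists>u\<in>A'. \<exists>v\<in>A. x = u + v"
      using P_in[of x] Q_in[of x] by (intro bexI[of _ "Q x"] bexI[of _ "P x"]) (simp_all add: Q_def)
  qed
qed (fact A A' isotropic isotropic')+

text \<open>
The projections of the dual families \<open>E\<close> and \<open>w\<close> to \<open>A\<close> and \<open>A'\<close>. They are dual to each other in the sense of
the expansions of \<open>P\<close> and \<open>Q\<close> below, and are indexed by \<open>E\<close>, so in general linearly dependent.
\<close>

definition a :: "'g \<Rightarrow> 'g" where "a e = P e"
definition b :: "'g \<Rightarrow> 'g" where "b e = Q (w e)"

lemma a_in: "a e \<in> A" and b_in: "b e \<in> A'"
  by (simp_all add: a_def b_def P_in Q_in)

lemma P_expand: "P v = (\<Sum>e\<in>E. scale (B v (b e)) (a e))"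
  using endo_expand[OF endo_P, of "P v"] unfolding P_id[OF P_in] P_adjoint a_def b_def .

lemma Q_expand: "Q v = (\<Sum>e\<in>E. scale (B v (a e)) (b e))"
proof -
  have "Q (Q v) = Q (\<Sum>e\<in>E. scale (B (Q v) e) (w e))"
    using arg_cong[OF dual_expansion[of "Q v"], of Q] .
  then show ?thesis
    unfolding Q_id[OF Q_in] endo_sum[OF endo_Q] endo_scale[OF endo_Q] Q_adjoint a_def b_def .
qed

lemma trace_P_frame:
  assumes f: "endo f"
  shows "trace (\<lambda>v. f (P v)) = (\<Sum>e\<in>E. B (f (a e)) (b e))"
proof -
  have "trace (\<lambda>v. f (P v)) = trace (\<lambda>v. f (P (P v)))" by (simp add: P_id[OF P_in])
  also have "\<dots> = trace (\<lambda>v. P (f (P v)))"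
    using trace_commute[OF endo_comp[OF f endo_P] endo_P] .
  also have "\<dots> = (\<Sum>e\<in>E. B (f (a e)) (b e))"
    by (simp add: trace_def P_adjoint a_def b_def)
  finally show ?thesis .
qed

lemma trace_Q_frame:
  assumes f: "endo f"
  shows "trace (\<lambda>v. f (Q v)) = (\<Sum>e\<in>E. B (f (b e)) (a e))"
proof -
  have "trace (\<lambda>v. f (Q v)) = trace (\<lambda>v. f (Q (Q v)))" by (simp add: Q_id[OF Q_in])
  also have "\<dots> = trace (\<lambda>v. Q (f (Q v)))"
    using trace_commute[OF endo_comp[OF f endo_Q] endo_Q] .
  also have "\<dots> = (\<Sum>e\<in>E. B (Q (f (Q (w e)))) e)"
    by (rule trace_dual[OF endo_comp[OF endo_Q endo_comp[OF f endo_Q]], symmetric])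
  also have "\<dots> = (\<Sum>e\<in>E. B (f (b e)) (a e))"
    by (simp add: Q_adjoint a_def b_def)
  finally show ?thesis .
qed

context
  fixes J :: "'g \<Rightarrow> 'g"
  assumes J: "endo J" and J_bracket: "\<And>x y. J (bracket x y) = bracket x (J y)"
    and J_sym: "\<And>x y. B (J x) y = B x (J y)"
begin

lemma J_bracket_left: "J (bracket x y) = bracket (J x) y"
proof -
  have "J (bracket x y) = - J (bracket y x)"
    unfolding bracket_skew[of x y] using endo_diff[OF J, of 0 "bracket y x"] endo_zero[OF J] by simp
  also have "\<dots> = bracket (J x) y" unfolding J_bracket bracket_skew[of "J x" y] ..
  finally show ?thesis .
qed

lemma J_swap: "B (J x) y = B (J y) x"
  unfolding J_sym[of x y] by (rule B_sym)

text \<open>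
For \<open>J = 1\<close> this is the full contraction of the structure constants of \<open>A\<close> with those of \<open>A'\<close>. All the quantities in
the strange formula are multiples of it.
\<close>

definition S :: real where
  "S = (\<Sum>i\<in>E. \<Sum>j\<in>E. B (J (bracket (b i) (b j))) (bracket (a i) (a j)))"

definition T :: real where
  "T = (\<Sum>i\<in>E. \<Sum>j\<in>E. B (J (bracket (b i) (a j))) (bracket (a i) (b j)))"

lemma S_alt: "S = (\<Sum>i\<in>E. \<Sum>j\<in>E. B (J (bracket (a i) (a j))) (bracket (b i) (b j)))"
  unfolding S_def by (intro sum.cong refl J_swap)

text \<open>
The component of \<open>[b\<^sub>i, a\<^sub>j]\<close> in \<open>A\<close> has coefficients \<open>- B(a\<^sub>j, [b\<^sub>i, b\<^sub>k])\<close>, the structure constants of \<open>A'\<close>. Summing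
over \<open>j\<close> then reassembles \<open>[b\<^sub>i, b\<^sub>k]\<close>, which lies in \<open>A'\<close> since \<open>A'\<close> is a subalgebra.
\<close>

lemma T_P_part: "(\<Sum>i\<in>E. \<Sum>j\<in>E. B (J (P (bracket (b i) (a j)))) (bracket (a i) (b j))) = S"
proof -
  have "(\<Sum>j\<in>E. B (J (P (bracket (b i) (a j)))) (bracket (a i) (b j))) =
    (\<Sum>k\<in>E. B (J (bracket (a i) (a k))) (bracket (b i) (b k)))" for i
  proof -
    have "(\<Sum>j\<in>E. B (J (P (bracket (b i) (a j)))) (bracket (a i) (b j))) =
      (\<Sum>j\<in>E. \<Sum>k\<in>E. B (bracket (b i) (a j)) (b k) * B (J (a k)) (bracket (a i) (b j)))"
      unfolding P_expand[of "bracket (b i) (a _)"] endo_sum[OF J] endo_scale[OF J] B_sum_left B_scale_left ..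
    also have "\<dots> = (\<Sum>k\<in>E. \<Sum>j\<in>E. - (B (J (a k)) (bracket (a i) (scale (B (bracket (b i) (b k)) (a j)) (b j)))))"
    proof (subst sum.swap, intro sum.cong refl)
      fix k j
      have "B (bracket (b i) (a j)) (b k) = - B (a j) (bracket (b i) (b k))" by (rule B_invariant)
      also have "B (a j) (bracket (b i) (b k)) = B (bracket (b i) (b k)) (a j)" by (rule B_sym)
      finally show "B (bracket (b i) (a j)) (b k) * B (J (a k)) (bracket (a i) (b j)) =
        - (B (J (a k)) (bracket (a i) (scale (B (bracket (b i) (b k)) (a j)) (b j))))"
        by (simp add: bracket_scale_right B_scale_right)
    qed
    also have "\<dots> = (\<Sum>k\<in>E. - B (J (a k)) (bracket (a i) (Q (bracket (b i) (b k)))))"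
      unfolding Q_expand by (simp only: sum_negf bracket_sum_right B_sum_right)
    also have "\<dots> = (\<Sum>k\<in>E. - B (J (a k)) (bracket (a i) (bracket (b i) (b k))))"
      by (simp add: Q_id[OF subalgebra_bracket[OF A' b_in b_in]])
    also have "\<dots> = (\<Sum>k\<in>E. B (J (bracket (a i) (a k))) (bracket (b i) (b k)))"
      by (simp add: J_bracket B_invariant)
    finally show ?thesis .
  qed
  then show ?thesis by (simp add: S_alt)
qed

text \<open>
The same computation for the component in \<open>A'\<close>, with the structure constants of \<open>A\<close> and a sum over \<open>i\<close>.
\<close>

lemma T_Q_part: "(\<Sum>i\<in>E. \<Sum>j\<in>E. B (J (Q (bracket (b i) (a j)))) (bracket (a i) (b j))) = S"
proof -
  have "(\<Sum>i\<in>E. B (J (Q (bracket (b i) (a j)))) (bracket (a i) (b j))) =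
    (\<Sum>k\<in>E. B (J (bracket (b j) (b k))) (bracket (a j) (a k)))" for j
  proof -
    have "(\<Sum>i\<in>E. B (J (Q (bracket (b i) (a j)))) (bracket (a i) (b j))) =
      (\<Sum>i\<in>E. \<Sum>k\<in>E. B (bracket (b i) (a j)) (a k) * B (J (b k)) (bracket (a i) (b j)))"
      unfolding Q_expand[of "bracket (b _) (a j)"] endo_sum[OF J] endo_scale[OF J] B_sum_left B_scale_left ..
    also have "\<dots> = (\<Sum>k\<in>E. \<Sum>i\<in>E. - B (J (b k)) (bracket (b j) (scale (B (bracket (a j) (a k)) (b i)) (a i))))"
    proof (subst sum.swap, intro sum.cong refl)
      fix k i
      have "B (bracket (b i) (a j)) (a k) = B (b i) (bracket (a j) (a k))" by (rule B_cyclic)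
      also have "\<dots> = B (bracket (a j) (a k)) (b i)" by (rule B_sym)
      finally show "B (bracket (b i) (a j)) (a k) * B (J (b k)) (bracket (a i) (b j)) =
        - B (J (b k)) (bracket (b j) (scale (B (bracket (a j) (a k)) (b i)) (a i)))"
        unfolding bracket_skew[of "a i" "b j"] by (simp add: bracket_scale_right B_scale_right)
    qed
    also have "\<dots> = (\<Sum>k\<in>E. - B (J (b k)) (bracket (b j) (P (bracket (a j) (a k)))))"
      unfolding P_expand by (simp only: sum_negf bracket_sum_right B_sum_right)
    also have "\<dots> = (\<Sum>k\<in>E. - B (J (b k)) (bracket (b j) (bracket (a j) (a k))))"
      by (simp add: P_id[OF subalgebra_bracket[OF A a_in a_in]])
    also have "\<dots> = (\<Sum>k\<in>E. B (J (bracket (b j) (b k))) (bracket (a j) (a k)))"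
      by (simp add: J_bracket B_invariant)
    finally show ?thesis .
  qed
  then show ?thesis unfolding S_def by (subst sum.swap) simp
qed

lemma T_eq: "T = 2 * S"
proof -
  have "T = (\<Sum>i\<in>E. \<Sum>j\<in>E. B (J (P (bracket (b i) (a j)))) (bracket (a i) (b j)) +
      B (J (Q (bracket (b i) (a j)))) (bracket (a i) (b j)))"
    by (simp add: T_def P_plus_Q flip: B_add_left endo_add[OF J])
  then show ?thesis unfolding sum.distrib T_P_part T_Q_part by simp
qed

text \<open>
Each Killing form is a trace, which splits into the traces over the dual families of \<open>A\<close> and of \<open>A'\<close>; moving
one bracket to the other side by invariance gives \<open>- T - S\<close>.
\<close>

lemma sum_killing: "(\<Sum>i\<in>E. killing (J (a i)) (b i)) = - 3 * S"
proof -
  have "killing (J (a i)) (b i) =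
    - (\<Sum>k\<in>E. B (J (bracket (b i) (a k))) (bracket (a i) (b k)))
    - (\<Sum>k\<in>E. B (J (bracket (b i) (b k))) (bracket (a i) (a k)))" for i
  proof -
    let ?f = "\<lambda>v. bracket (J (a i)) (bracket (b i) v)"
    have f: "endo ?f" by (rule endo_comp[OF endo_bracket endo_bracket])
    have "B (?f x) y = - B (J (bracket (b i) x)) (bracket (a i) y)" for x y
      unfolding J_bracket_left[symmetric] J_bracket B_invariant ..
    then show ?thesis
      unfolding killing_def trace_P[OF f] trace_P_frame[OF f] trace_Q_frame[OF f]
      by (simp add: sum_negf)
  qed
  then have "(\<Sum>i\<in>E. killing (J (a i)) (b i)) = - T - S"
    by (simp add: sum_subtractf sum_negf S_def T_def)
  then show ?thesis using T_eq by simp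
qed

text \<open>
By the Jacobi identity \<open>ad [a\<^sub>i, b\<^sub>i]\<close> is a commutator, and its two terms give \<open>S\<close> and \<open>- T\<close>.
\<close>

lemma norm_sum_brackets:
  "B (\<Sum>i\<in>E. bracket (a i) (b i)) (J (\<Sum>j\<in>E. bracket (a j) (b j))) = - S"
proof -
  have "B (bracket (a i) (b i)) (J (bracket (a j) (b j))) =
    B (J (bracket (b i) (b j))) (bracket (a i) (a j)) - B (J (bracket (b i) (a j))) (bracket (a i) (b j))" for i j
  proof -
    have "B (bracket (a i) (b i)) (J (bracket (a j) (b j))) = B (bracket (bracket (a i) (b i)) (J (a j))) (b j)"
      unfolding J_bracket_left B_cyclic ..
    also have "\<dots> = B (bracket (a i) (bracket (b i) (J (a j)))) (b j) - B (bracket (b i) (bracket (a i) (J (a j)))) (b j)"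
      unfolding bracket_bracket B_diff_left ..
    also have "\<dots> = - B (J (bracket (b i) (a j))) (bracket (a i) (b j)) + B (J (bracket (a i) (a j))) (bracket (b i) (b j))"
      unfolding B_invariant[of "a i" "bracket (b i) (J (a j))"]
        B_invariant[of "b i" "bracket (a i) (J (a j))"] J_bracket by simp
    also have "B (J (bracket (a i) (a j))) (bracket (b i) (b j)) = B (J (bracket (b i) (b j))) (bracket (a i) (a j))"
      by (rule J_swap)
    finally show ?thesis by simp
  qed
  then have "B (\<Sum>i\<in>E. bracket (a i) (b i)) (J (\<Sum>j\<in>E. bracket (a j) (b j))) = S - T"
    unfolding B_sum_left unfolding endo_sum[OF J] B_sum_right
    by (simp add: sum_subtractf S_def T_def)
  then show ?thesis using T_eq by simp
qed

text \<open>
For \<open>J = 1\<close> and a splitting that comes from a triangular decomposition, the sum of the brackets represents, up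
to sign, the sum of the positive roots, and the formula becomes the strange formula for its norm.
\<close>

lemma strange_formula:
  "(\<Sum>i\<in>E. killing (J (a i)) (b i)) =
    3 * B (\<Sum>i\<in>E. bracket (a i) (b i)) (J (\<Sum>j\<in>E. bracket (a j) (b j)))"
  using sum_killing norm_sum_brackets by simp

end

end

section \<open>The Killing operator and unimodularity\<close>

context metrized_lie_algebra
begin

lemma trace_bracket: "trace (bracket x) = 0"
proof -
  have "trace (bracket x) = trace (\<lambda>v. scale (- 1) (bracket x v))"
    by (rule trace_adjoint) (simp_all add: endo_def bracket_add_right bracket_scale_right
        scale_right_distrib B_scale_right B_invariant mult.commute)
  then show ?thesis unfolding trace_scale by simp
qed

text \<open>
Vectors outside a subspace are separated from it by a linear form, and linear forms are represented by \<open>B\<close>.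
\<close>

lemma separation:
  assumes W: "subspace W" and v: "v \<notin> W"
  obtains x where "\<And>y. y \<in> W \<Longrightarrow> B y x = 0" "B v x \<noteq> 0"
proof -
  obtain Bs where Bs: "Bs \<subseteq> W" "independent Bs" "W \<subseteq> span Bs"
    by (rule basis_exists)
  have "span Bs \<subseteq> W" using Bs(1) W by (rule span_minimal)
  then have nv: "v \<notin> span Bs" using v by blast
  then have ind: "independent (insert v Bs)" using Bs(2) by (rule independent_insertI)
  interpret pair: vector_space_pair scale "(*) :: real \<Rightarrow> real \<Rightarrow> real"
    by (rule vector_space_pair.intro[OF vector_space_axioms], unfold_locales)
      (simp_all add: distrib_left distrib_right)
  from pair.linear_independent_extend[OF ind, of "\<lambda>x. if x = v then 1 else 0"]
  obtain g where gg: "Vector_Spaces.linear scale (*) g \<and>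
    (\<forall>x\<in>insert v Bs. g x = (if x = v then 1 else 0))" ..
  have g: "Vector_Spaces.linear scale (*) g" using gg ..
  have g': "\<forall>x\<in>insert v Bs. g x = (if x = v then 1 else 0)" using gg ..
  interpret g: Vector_Spaces.linear scale "(*)" g by (fact g)
  define x where "x = (\<Sum>e\<in>E. scale (g e) (w e))"
  have Bx: "B y x = g y" for y
  proof -
    have "g y = g (\<Sum>e\<in>E. scale (B y (w e)) e)" using arg_cong[OF expansion[of y], of g] .
    then have "g y = (\<Sum>e\<in>E. B y (w e) * g e)" by (simp only: g.sum g.scale)
    then show "B y x = g y" by (simp only: x_def B_sum_right B_scale_right mult.commute)
  qed
  have v1: "B v x \<noteq> 0" using g' by (simp add: Bx)
  have y0: "B y x = 0" if y: "y \<in> W" for y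
  proof -
    have "g u = 0" if u: "u \<in> Bs" for u
    proof -
      have "u \<noteq> v" using span_base[OF u] nv by blast
      then show ?thesis using g' u by simp
    qed
    moreover have "y \<in> span Bs" using y Bs by blast
    ultimately have "g y = 0" by (rule g.eq_0_on_span)
    then show "B y x = 0" by (simp add: Bx)
  qed
  show thesis by (rule that[OF y0 v1])
qed

text \<open>
The operator that represents the Killing form with respect to \<open>B\<close>.
\<close>

definition D :: "'g \<Rightarrow> 'g" where
  "D x = (\<Sum>e\<in>E. scale (killing x e) (w e))"

lemma killing_sum_right: "killing x (\<Sum>e\<in>I. f e) = (\<Sum>e\<in>I. killing x (f e))"
proof (induction I rule: infinite_finite_induct)
  case (insert a I)
  then show ?case by (simp add: killing_commute[of x] killing_add_left)
qed (use killing_scale_left[of 0 0] in \<open>simp_all add: killing_commute[of x]\<close>)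

lemma killing_scale_right: "killing x (scale c y) = c * killing x y"
  unfolding killing_commute[of x] by (rule killing_scale_left)

lemma B_D: "B (D x) y = killing x y"
proof -
  have "killing x y = killing x (\<Sum>e\<in>E. scale (B y (w e)) e)"
    using arg_cong[OF expansion[of y], of "killing x"] .
  also have "\<dots> = (\<Sum>e\<in>E. killing x e * B (w e) y)"
    by (simp add: killing_sum_right killing_scale_right B_sym[of y] mult.commute)
  also have "\<dots> = B (D x) y"
    by (simp add: D_def B_sum_left B_scale_left)
  finally show ?thesis ..
qed

lemma endo_D: "endo D"
  by (simp add: endo_def D_def killing_add_left killing_scale_left scale_left_distrib sum.distrib
      scale_sum_right)

lemma killing_minus_left: "killing (- x) y = - killing x y"
  using killing_scale_left[of "- 1" x y] by simp

lemma D_bracket: "D (bracket x y) = bracket x (D y)"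
proof (rule eq_if_B_eq)
  fix z
  have "killing (bracket x y) z = - killing (bracket y x) z"
    unfolding bracket_skew[of x y] by (rule killing_minus_left)
  then show "B (D (bracket x y)) z = B (bracket x (D y)) z"
    unfolding B_invariant B_D killing_invariant .
qed

lemma D_sym: "B (D x) y = B x (D y)"
  unfolding B_D B_sym[of x "D y"] by (rule killing_commute)

lemma D_pow_bracket: "(D ^^ k) (bracket x y) = bracket x ((D ^^ k) y)"
  by (induction k) (simp_all add: D_bracket)

lemma D_pow_sym: "B ((D ^^ k) x) y = B x ((D ^^ k) y)"
proof (induction k arbitrary: x y)
  case (Suc k)
  have "B ((D ^^ Suc k) x) y = B ((D ^^ k) x) (D y)" by (simp add: D_sym)
  also have "\<dots> = B x ((D ^^ k) (D y))" by (rule Suc)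
  also have "(D ^^ k) (D y) = (D ^^ Suc k) y" by (simp only: funpow_Suc_right o_apply)
  finally show ?case .
qed simp

lemma killing_subalgebra_radical:
  assumes A: "subalgebra A"
  shows "ideal_of {x \<in> A. \<forall>y\<in>A. killing x y = 0} A"
proof -
  have "killing 0 y = 0" for y using killing_scale_left[of 0 0 y] by simp
  moreover have "killing (bracket x y) z = 0"
    if "x \<in> A" "z \<in> A" "\<forall>z\<in>A. killing y z = 0" for x y z
  proof -
    have "killing (bracket x y) z = - killing (bracket y x) z"
      unfolding bracket_skew[of x y] by (rule killing_minus_left)
    also have "\<dots> = 0" unfolding killing_invariant using that A by (simp add: subalgebra_def)
    finally show ?thesis .
  qed
  ultimately show ?thesis
    using A by (auto simp: ideal_of_def subalgebra_def subspace_def killing_add_left killing_scale_left)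
qed

end

context lagrangian_splitting
begin

text \<open>
For \<open>x\<close> in \<open>A\<close> this is the trace of \<open>ad x\<close> on \<open>A\<close>, written \<open>\<tau> x\<close> below. Let \<open>s\<close> be the radical of the Killing
form restricted to \<open>A\<close>, and \<open>r\<close> the set of all \<open>t\<close> with \<open>[t, A] \<subseteq> s\<close>. By Cartan's criterion \<open>r\<close> is a solvable
ideal, so \<open>[r, A]\<close> lies in \<open>n\<close> and is central. Therefore \<open>\<tau>\<close> vanishes on \<open>r\<close>, in particular on \<open>s\<close>, and is
represented by the Killing form: \<open>\<tau> = K(t, _)\<close> with \<open>t\<close> in \<open>A\<close>. Since \<open>\<tau>\<close> vanishes on brackets, \<open>t\<close> lies in \<open>r\<close>.
But \<open>K(r, A) = 0\<close>, again because \<open>[r, A]\<close> is central.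
\<close>

lemma adjoint_trace_zero:
  assumes rad: "is_nilpotent_radical n A" and cen: "\<And>x y. x \<in> n \<Longrightarrow> bracket x y = 0"
    and x: "x \<in> A"
  shows "trace (\<lambda>v. bracket x (P v)) = 0"
proof -
  define \<tau> where "\<tau> x = trace (\<lambda>v. bracket x (P v))" for x
  define s where "s = {x \<in> A. \<forall>y\<in>A. killing x y = 0}"
  define r where "r = {t \<in> A. \<forall>y\<in>A. bracket t y \<in> s}"
  have brA: "bracket x y \<in> A" if "x \<in> A" "y \<in> A" for x y using subalgebra_bracket[OF A that] .
  have s: "ideal_of s A" unfolding s_def by (rule killing_subalgebra_radical[OF A])
  have cen': "bracket y x = 0" if "x \<in> n" for x y
    using cen[OF that, of y] bracket_skew[of y x] by simp
  have nA: "n \<subseteq> A" using rad by (auto simp: is_nilpotent_radical_def nilpotent_ideal_of_def ideal_of_def)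
  have r: "ideal_of r A"
    unfolding ideal_of_def
  proof (intro conjI ballI)
    show "subspace r" "r \<subseteq> A"
      using A_sub ideal_subspace[OF s]
      by (auto simp: r_def subspace_def bracket_add_left bracket_scale_left)
    fix x t assume x: "x \<in> A" and t: "t \<in> r"
    have "bracket (bracket x t) y \<in> s" if y: "y \<in> A" for y
      unfolding bracket_bracket using x t y brA
      by (intro subspace_diff[OF ideal_subspace[OF s]]) (auto simp: r_def intro: ideal_bracket[OF s])
    then show "bracket x t \<in> r" using x t brA by (auto simp: r_def)
  qed
  have rA: "r \<subseteq> A" by (rule ideal_subset[OF r])
  have sr: "s \<subseteq> r"
  proof
    fix t assume t: "t \<in> s"
    have "bracket t y \<in> s" if "y \<in> A" for y
      using ideal_bracket[OF s that t] subspace_neg[OF ideal_subspace[OF s]] bracket_skew[of t y] by simp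
    then show "t \<in> r" using t by (simp add: r_def s_def)
  qed
  have "solvable r"
  proof (rule derived_series_solvable, rule cartan_criterion)
    show "subalgebra (commutator r r)"
      using r by (intro subalgebra_commutator) (auto simp: subalgebra_def ideal_of_def)
    have sub: "commutator r r \<subseteq> s"
      using rA by (intro commutator_least ideal_subspace[OF s]) (auto simp: r_def)
    show "killing x y = 0" if "x \<in> commutator r r" "y \<in> commutator r r" for x y
      using that sub by (auto simp: s_def)
  qed
  then have "commutator A r \<subseteq> n"
    by (rule commutator_solvable_subset_radical[OF lie_algebra_axioms A rad _ r, rotated]) (rule cen)
  then have rn: "bracket t y \<in> n" if "t \<in> r" "y \<in> A" for t y
  proof -
    have "- bracket y t \<in> n"
      using bracket_mem_commutator[OF that(2,1)] \<open>commutator A r \<subseteq> n\<close> rad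
      by (auto simp: is_nilpotent_radical_def nilpotent_ideal_of_def ideal_of_def intro: subspace_neg)
    then show ?thesis using bracket_skew[of t y] by simp
  qed
  have nP: "P x = x" if "x \<in> n" for x using that nA by (intro P_id) blast
  have \<tau>_bracket: "\<tau> (bracket x y) = 0" if "x \<in> A" "y \<in> A" for x y
  proof -
    have P: "P (bracket z (P v)) = bracket z (P v)" if "z \<in> A" for z v
      using brA[OF that P_in] by (rule P_id)
    have e: "endo (\<lambda>v. bracket z (P v))" for z by (rule endo_comp[OF endo_bracket endo_P])
    show ?thesis
      using trace_commute[OF e[of x] e[of y]]
      by (simp add: \<tau>_def bracket_bracket trace_diff P[OF that(1)] P[OF that(2)])
  qed
  have \<tau>_r: "\<tau> x = 0" if x: "x \<in> r" for x
    unfolding \<tau>_def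
  proof (rule trace_nilpotent[where k = 2])
    show "endo (\<lambda>v. bracket x (P v))" by (rule endo_comp[OF endo_bracket endo_P])
    show "((\<lambda>v. bracket x (P v)) ^^ 2) v = 0" for v
      using rn[OF x P_in, of v] by (simp add: numeral_2_eq_2 nP cen')
  qed
  have K_r: "killing t x = 0" if t: "t \<in> r" and x: "x \<in> A" for t x
  proof -
    let ?f = "\<lambda>v. bracket t (bracket x v)" and ?g = "\<lambda>v. bracket x (bracket t v)"
    have f: "endo ?f" and g: "endo ?g" by (rule endo_comp[OF endo_bracket endo_bracket])+
    have "trace (\<lambda>v. ?f (P v)) = 0"
    proof (rule trace_nilpotent[where k = 2])
      show "endo (\<lambda>v. ?f (P v))" by (rule endo_comp[OF f endo_P])
      show "((\<lambda>v. ?f (P v)) ^^ 2) v = 0" for v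
        using rn[OF t brA[OF x P_in], of v] by (simp add: numeral_2_eq_2 nP cen')
    qed
    moreover have "trace (\<lambda>v. ?f (Q v)) = 0"
    proof -
      have "trace (\<lambda>v. ?f (Q v)) = trace (\<lambda>v. P (?g v))"
        by (rule trace_adjoint[OF endo_comp[OF endo_P g]]) (simp add: B_invariant Q_adjoint)
      also have "\<dots> = trace (\<lambda>v. ?g (P v))" by (rule trace_commute[OF endo_P g])
      also have "\<dots> = 0" using rn[OF t P_in] by (simp add: cen')
      finally show ?thesis .
    qed
    ultimately show ?thesis unfolding killing_def trace_P[OF f] by simp
  qed
  \<comment> \<open>the vector representing \<open>\<tau>\<close>\<close>
  define u where "u = (\<Sum>e\<in>E. bracket (a e) (b e))"
  have Bu: "B y u = \<tau> y" for y
    unfolding u_def \<tau>_def trace_P_frame[OF endo_bracket] B_sum_right B_cyclic ..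
  have \<tau>_P: "\<tau> (P y) = B (Q u) y" for y
    unfolding Bu[symmetric] P_adjoint by (rule B_sym)
  have QD: "endo (\<lambda>t. Q (D t))" by (rule endo_comp[OF endo_Q endo_D])
  have W: "subspace ((\<lambda>t. Q (D t)) ` A)"
    unfolding subspace_def
  proof (intro conjI ballI allI)
    show "0 \<in> (\<lambda>t. Q (D t)) ` A"
      using endo_zero[OF QD] subspace_0[OF A_sub] by (intro image_eqI[of _ _ 0]) simp_all
    show "x + y \<in> (\<lambda>t. Q (D t)) ` A" if "x \<in> (\<lambda>t. Q (D t)) ` A" "y \<in> (\<lambda>t. Q (D t)) ` A" for x y
      using that subspace_add[OF A_sub] by (auto simp flip: endo_add[OF QD])
    show "scale c x \<in> (\<lambda>t. Q (D t)) ` A" if "x \<in> (\<lambda>t. Q (D t)) ` A" for c x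
      using that subspace_scale[OF A_sub] by (auto simp flip: endo_scale[OF QD])
  qed
  \<comment> \<open>otherwise some \<open>y\<close> separates \<open>Q u\<close> from the image; then \<open>P y\<close> lies in \<open>s\<close>, where \<open>\<tau>\<close> vanishes, although
    \<open>\<tau> (P y) = B (Q u) y\<close>\<close>
  have "Q u \<in> (\<lambda>t. Q (D t)) ` A"
  proof (rule ccontr)
    assume "Q u \<notin> (\<lambda>t. Q (D t)) ` A"
    then obtain y where y: "\<And>v. v \<in> (\<lambda>t. Q (D t)) ` A \<Longrightarrow> B v y = 0" "B (Q u) y \<noteq> 0"
      using separation[OF W] by blast
    have "killing (P y) t = 0" if "t \<in> A" for t
      using y(1)[of "Q (D t)"] that by (simp add: Q_adjoint B_D killing_commute)
    then have "P y \<in> r" using sr P_in by (auto simp: s_def)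
    then have "\<tau> (P y) = 0" by (rule \<tau>_r)
    then show False using y(2) by (simp add: \<tau>_P)
  qed
  then obtain t where t: "t \<in> A" "Q u = Q (D t)" by blast
  have \<tau>_t: "\<tau> y = killing t y" if "y \<in> A" for y
  proof -
    have "\<tau> y = B (Q u) y" using \<tau>_P[of y] P_id[OF that] by simp
    also have "\<dots> = killing t y" using P_id[OF that] by (simp add: t(2) Q_adjoint B_D)
    finally show ?thesis .
  qed
  have "killing (bracket t y) z = 0" if "y \<in> A" "z \<in> A" for y z
    using \<tau>_t[OF brA[OF that]] \<tau>_bracket[OF that] by (simp add: killing_invariant)
  then have "t \<in> r" using t(1) brA by (auto simp: r_def s_def)
  then show ?thesis using K_r[OF _ x] \<tau>_t[OF x] by (simp add: \<tau>_def)
qed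

text \<open>
The sum of the brackets represents \<open>x \<mapsto> tr (ad x \<circ> P)\<close>. On \<open>A\<close> this is the trace of \<open>ad x\<close> on \<open>A\<close>. On \<open>A'\<close> it is minus
the trace of \<open>ad x\<close> on \<open>A'\<close>, since \<open>ad x\<close> has trace zero on the whole algebra.
\<close>

lemma sum_brackets_zero:
  assumes "is_nilpotent_radical n A" "\<And>x y. x \<in> n \<Longrightarrow> bracket x y = 0"
    and "is_nilpotent_radical n' A'" "\<And>x y. x \<in> n' \<Longrightarrow> bracket x y = 0"
  shows "(\<Sum>e\<in>E. bracket (a e) (b e)) = 0"
proof (rule nondegenerate)
  interpret sw: lagrangian_splitting scale bracket B E w A' A by (rule swap)
  have swP: "sw.P x = Q x" for x
    by (rule sw.P_unique[OF Q_in]) (simp add: Q_def P_in)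
  fix y
  have tr0: "trace (\<lambda>v. bracket x (P v)) = 0" for x
  proof -
    have "trace (\<lambda>v. bracket x (P v)) = trace (\<lambda>v. bracket (P x) (P v)) + trace (\<lambda>v. bracket (Q x) (P v))"
      by (simp add: P_plus_Q flip: trace_add bracket_add_left)
    moreover have "trace (\<lambda>v. bracket (P x) (P v)) = 0"
      by (rule adjoint_trace_zero[OF assms(1) _ P_in]) (rule assms(2))
    moreover have "trace (\<lambda>v. bracket (Q x) (sw.P v)) = 0"
      by (rule sw.adjoint_trace_zero[OF assms(3) _ Q_in]) (rule assms(4))
    moreover have "trace (bracket (Q x)) = trace (\<lambda>v. bracket (Q x) (P v)) + trace (\<lambda>v. bracket (Q x) (Q v))"
      by (rule trace_P[OF endo_bracket])
    ultimately show ?thesis by (simp add: trace_bracket swP)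
  qed
  have "B y (\<Sum>e\<in>E. bracket (a e) (b e)) = trace (\<lambda>v. bracket y (P v))"
    unfolding trace_P_frame[OF endo_bracket] B_sum_right B_cyclic ..
  then show "B (\<Sum>e\<in>E. bracket (a e) (b e)) y = 0" by (simp add: B_sym tr0)
qed

text \<open>
The strange formula for \<open>J = D\<^sup>k\<close> gives \<open>tr (D\<^sup>k\<^sup>+\<^sup>1 P) = 0\<close>; since \<open>Q\<close> is the adjoint of \<open>P\<close>, also \<open>tr (D\<^sup>k\<^sup>+\<^sup>1 Q) = 0\<close>.
\<close>

lemma D_nilpotent:
  assumes u: "(\<Sum>e\<in>E. bracket (a e) (b e)) = 0"
  shows "\<exists>k. \<forall>x. (D ^^ k) x = 0"
proof (rule nilpotent_if_traces_zero[OF endo_D])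
  fix k
  have f: "endo (D ^^ Suc k)" by (rule endo_funpow[OF endo_D])
  have "(\<Sum>e\<in>E. killing ((D ^^ k) (a e)) (b e)) = 0"
    using strange_formula[of "D ^^ k", OF endo_funpow[OF endo_D] D_pow_bracket D_pow_sym]
    by (simp add: u)
  then have P: "trace (\<lambda>v. (D ^^ Suc k) (P v)) = 0"
    unfolding trace_P_frame[OF f] by (simp add: B_D)
  have "trace (\<lambda>v. (D ^^ Suc k) (Q v)) = trace (\<lambda>v. P ((D ^^ Suc k) v))"
    by (rule trace_adjoint[OF endo_comp[OF endo_P f]]) (simp only: D_pow_sym Q_adjoint)
  also have "\<dots> = 0" unfolding trace_commute[OF endo_P f] by (rule P)
  finally show "trace (D ^^ Suc k) = 0" unfolding trace_P[OF f] P by simp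
qed

end

section \<open>Nilpotency of the Killing operator forces commutativity\<close>

context metrized_lie_algebra
begin

text \<open>
The consequence of reductivity that survives the restriction to real scalars and suffices for the rest of
the argument: an ideal \<open>b\<close> is central as soon as \<open>[b, b]\<close> is.
\<close>

definition two_step_ideals_central :: bool where
  "two_step_ideals_central \<longleftrightarrow> (\<forall>b. ideal_of b UNIV \<longrightarrow>
    (\<forall>x\<in>b. \<forall>y\<in>b. \<forall>z. bracket (bracket x y) z = 0) \<longrightarrow> (\<forall>x\<in>b. \<forall>y. bracket x y = 0))"

lemma two_step_ideal_central:
  assumes two_step_ideals_central "ideal_of b UNIV"
    and "\<And>x y z. x \<in> b \<Longrightarrow> y \<in> b \<Longrightarrow> bracket (bracket x y) z = 0" and "x \<in> b"
  shows "bracket x y = 0"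
  using assms unfolding two_step_ideals_central_def by blast

context
  assumes red: two_step_ideals_central
begin

lemmas two_step_central = two_step_ideal_central[OF red]

lemma UNIV_subalgebra: "subalgebra UNIV"
  by (simp add: subalgebra_def)

text \<open>
Centrality climbs up the derived series, from its zero term to the ideal itself.
\<close>

lemma solvable_ideal_central:
  assumes b: "ideal_of b UNIV" and "solvable b" and "x \<in> b"
  shows "bracket x y = 0"
proof -
  let ?D = "\<lambda>k. ((\<lambda>a. commutator a a) ^^ k) b"
  have id: "ideal_of (?D k) UNIV" for k by (rule ideal_derived_series[OF UNIV_subalgebra b])
  obtain k where k: "?D k = {0}" using assms(2) by (auto simp: solvable_def)
  have "(\<forall>x \<in> ?D k. \<forall>y. bracket x y = 0) \<Longrightarrow> (\<forall>x \<in> ?D 0. \<forall>y. bracket x y = 0)" for k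
  proof (induction k)
    case 0
    then show ?case by blast
  next
    case (Suc k)
    have "bracket x y = 0" if "x \<in> ?D k" for x y
    proof (rule two_step_central[OF id _ that])
      fix x y z assume "x \<in> ?D k" "y \<in> ?D k"
      then have "bracket x y \<in> ?D (Suc k)" by (simp add: bracket_mem_commutator)
      then show "bracket (bracket x y) z = 0" using Suc.prems by blast
    qed
    then show ?case using Suc.IH by blast
  qed
  from this[of k] k have "\<forall>x \<in> ?D 0. \<forall>y. bracket x y = 0" by simp
  then show ?thesis using assms(3) by simp
qed

text \<open>
If \<open>D x\<close> is central, then \<open>D [x, y] = [D x, y] = 0\<close>, so \<open>[x, y]\<close> is in the radical of the Killing form, which
is solvable and hence central. Thus \<open>x\<close> is in the second center, which is an ideal with central brackets
and therefore equals the center.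
\<close>

lemma commutative_if_D_nilpotent:
  assumes "\<exists>k. \<forall>x. (D ^^ k) x = 0"
  shows "bracket x y = 0"
proof -
  define Z where "Z = {x. \<forall>y. bracket x y = 0}"
  have killing_Z: "killing x y = 0" if "x \<in> Z" for x y
    using that by (simp add: killing_def Z_def)
  have rad_Z: "x \<in> Z" if "\<And>y. killing x y = 0" for x
  proof -
    let ?R = "{x \<in> UNIV. \<forall>y\<in>UNIV. killing x y = 0}"
    have id: "ideal_of ?R UNIV" by (rule killing_subalgebra_radical[OF UNIV_subalgebra])
    then have "subalgebra ?R" by (auto simp: ideal_of_def subalgebra_def)
    then have "solvable ?R" by (rule cartan_criterion) auto
    then show ?thesis unfolding Z_def using solvable_ideal_central[OF id] that by blast
  qed
  have ZZ: "x \<in> Z" if x: "\<And>y. bracket x y \<in> Z" for x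
  proof -
    let ?b = "{x. \<forall>y. bracket x y \<in> Z}"
    have "ideal_of ?b UNIV"
      unfolding ideal_of_def
    proof (intro conjI ballI)
      show "subspace ?b" by (auto simp: subspace_def Z_def bracket_add_left bracket_scale_left)
      fix u x assume x: "x \<in> ?b"
      have x0: "bracket (bracket x y) z = 0" for y z using x by (simp add: Z_def)
      have "bracket (bracket (bracket u x) y) z = 0" for y z
        unfolding bracket_bracket[of u x y] bracket_diff_left bracket_bracket[of u "bracket x y"]
        by (simp add: x0)
      then show "bracket u x \<in> ?b" by (simp add: Z_def)
    qed simp
    then have "bracket x y = 0" for y
      by (rule two_step_central) (use x in \<open>auto simp: Z_def\<close>)
    then show ?thesis by (simp add: Z_def)
  qed
  have D_Z: "x \<in> Z" if "D x \<in> Z" for x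
  proof (rule ZZ, rule rad_Z)
    fix y z
    have "killing (bracket x y) z = B (D (bracket x y)) z" by (simp add: B_D)
    also have "D (bracket x y) = - bracket y (D x)"
      unfolding bracket_skew[of x y] using endo_diff[OF endo_D, of 0 "bracket y x"] endo_zero[OF endo_D]
      by (simp add: D_bracket)
    also have "\<dots> = 0" using that bracket_skew[of y "D x"] by (simp add: Z_def)
    finally show "killing (bracket x y) z = 0" by simp
  qed
  have "(D ^^ k) x \<in> Z \<Longrightarrow> x \<in> Z" for k x
    by (induction k) (auto intro: D_Z)
  moreover obtain k where "(D ^^ k) x = 0" using assms by blast
  then have "(D ^^ k) x \<in> Z" by (simp add: Z_def)
  ultimately have "x \<in> Z" by blast
  then show ?thesis by (simp add: Z_def)
qed

text \<open>
The adjoint action of \<open>A\<close> on the whole algebra is a representation of \<open>A\<close>; so the elements of \<open>n\<close> are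
\<open>ad\<close>-nilpotent there, and \<open>n\<close> is a solvable ideal.
\<close>

lemma radical_central:
  assumes A: "subalgebra A" and rad: "is_nilpotent_radical n A"
    and norm: "\<And>x y. y \<in> n \<Longrightarrow> bracket x y \<in> n" and x: "x \<in> n"
  shows "bracket x y = 0"
proof -
  have n: "ideal_of n A" and nil: "\<And>x. x \<in> n \<Longrightarrow> acts_nilpotently A x"
    using rad by (auto simp: is_nilpotent_radical_def nilpotent_ideal_of_def)
  have id: "ideal_of n UNIV" using ideal_subspace[OF n] norm by (simp add: ideal_of_def)
  have sub: "subalgebra n" using ideal_subspace[OF n] norm by (simp add: subalgebra_def)
  have rep: "lie_representation A (card E) (\<lambda>x. mat_of (bracket x))"
    unfolding lie_representation_def
  proof (intro conjI ballI allI)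
    fix x y c
    have "bracket (x + y) = (\<lambda>v. bracket x v + bracket y v)" by (simp add: fun_eq_iff bracket_add_left)
    then show "mat_of (bracket (x + y)) = mat_of (bracket x) + mat_of (bracket y)"
      by (simp add: mat_of_add)
    have "bracket (scale c x) = (\<lambda>v. scale c (bracket x v))" by (simp add: fun_eq_iff bracket_scale_left)
    then show "mat_of (bracket (scale c x)) = c \<cdot>\<^sub>m mat_of (bracket x)" by (simp add: mat_of_scale)
    have "bracket (bracket x y) = (\<lambda>v. bracket x (bracket y v) - bracket y (bracket x v))"
      by (simp add: fun_eq_iff bracket_bracket)
    then have "mat_of (bracket (bracket x y)) =
        mat_of (\<lambda>v. bracket x (bracket y v)) - mat_of (\<lambda>v. bracket y (bracket x v))"
      by (simp add: mat_of_diff)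
    then show "mat_of (bracket (bracket x y)) =
        mat_of (bracket x) * mat_of (bracket y) - mat_of (bracket y) * mat_of (bracket x)"
      unfolding mat_of_comp[OF endo_bracket, of x "bracket y"] mat_of_comp[OF endo_bracket, of y "bracket x"] .
  qed simp
  have "\<exists>k. \<forall>v. (bracket x ^^ k) v = 0" if x: "x \<in> n" for x
  proof -
    obtain k where "mat_of (bracket x) ^\<^sub>m k = 0\<^sub>m (card E) (card E)"
      using nil[OF x] rep unfolding acts_nilpotently_def by blast
    then show ?thesis by (rule nilpotent_if_mat_of_nilpotent[OF endo_bracket])
  qed
  then have "solvable n" by (rule solvable_if_ad_nilpotent[OF sub])
  then show ?thesis using solvable_ideal_central[OF id] x by blast
qed

end

end

lemma (in lagrangian_splitting) commutative_if_radicals_normalized: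
  assumes red: two_step_ideals_central
    and "is_nilpotent_radical n A" "\<And>x y. y \<in> n \<Longrightarrow> bracket x y \<in> n"
    and "is_nilpotent_radical n' A'" "\<And>x y. y \<in> n' \<Longrightarrow> bracket x y \<in> n'"
  shows "bracket x y = 0"
proof -
  have "bracket x y = 0" if "x \<in> n" for x y
    by (rule radical_central[OF red A assms(2) _ that]) (rule assms(3))
  moreover have "bracket x y = 0" if "x \<in> n'" for x y
    by (rule radical_central[OF red A' assms(4) _ that]) (rule assms(5))
  ultimately have "(\<Sum>e\<in>E. bracket (a e) (b e)) = 0"
    using assms(2,4) by (intro sum_brackets_zero) blast+
  then have "\<exists>k. \<forall>x. (D ^^ k) x = 0" by (rule D_nilpotent)
  then show ?thesis by (rule commutative_if_D_nilpotent[OF red])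
qed

section \<open>Complex reductive Lie algebras as real Lie algebras\<close>

context lie_algebra
begin

definition center :: "'g set" where "center = {z. \<forall>x. bracket z x = 0}"

text \<open>
An ideal complementary to the center contains all brackets, since central components do not contribute
to them.
\<close>

lemma reductive_center_commutator:
  assumes reductive and z: "bracket x y \<in> center"
  shows "bracket x y = 0"
proof -
  have cen: "bracket u v = 0" "bracket v u = 0" if "u \<in> center" for u v
    using that bracket_skew[of v u] by (auto simp: center_def)
  have "subspace center"
    by (auto simp: subspace_def center_def bracket_add_left bracket_scale_left)
  moreover have "bracket v u \<in> center" if "u \<in> center" for u v
    using cen(2)[OF that] by (simp add: center_def)
  ultimately have "ideal_of center UNIV" by (simp add: ideal_of_def)
  then obtain m where m: "ideal_of m UNIV" "direct_sum_decomposition center m"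
    using assms(1) unfolding reductive_def by blast
  obtain u v where uv: "u \<in> center" "v \<in> m" "x = u + v"
    using m(2) unfolding direct_sum_decomposition_def by blast
  obtain u' v' where uv': "u' \<in> center" "v' \<in> m" "y = u' + v'"
    using m(2) unfolding direct_sum_decomposition_def by blast
  have "bracket x y = bracket v v'"
    using cen[OF uv(1)] cen[OF uv'(1)] by (simp add: uv(3) uv'(3) bracket_add_left bracket_add_right)
  also have "\<dots> \<in> m" using ideal_bracket[OF m(1)] uv'(2) by simp
  finally show ?thesis using z m(2) unfolding direct_sum_decomposition_def by blast
qed

lemma reductive_abelian_ideal_central:
  assumes reductive and a: "ideal_of a UNIV"
    and ab: "\<And>x y. x \<in> a \<Longrightarrow> y \<in> a \<Longrightarrow> bracket x y = 0" and x: "x \<in> a"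
  shows "bracket x y = 0"
proof -
  obtain m where m: "ideal_of m UNIV" "direct_sum_decomposition a m"
    using assms(1) a unfolding reductive_def by blast
  obtain u v where uv: "u \<in> a" "v \<in> m" "y = u + v"
    using m(2) unfolding direct_sum_decomposition_def by blast
  have xv: "bracket x y = bracket x v"
    using ab[OF x uv(1)] by (simp add: uv(3) bracket_add_right)
  have "bracket x v \<in> m" using ideal_bracket[OF m(1)] uv(2) by simp
  moreover have "- bracket v x \<in> a"
    using ideal_bracket[OF a, of v x] x subspace_neg[OF ideal_subspace[OF a]] by simp
  then have "bracket x v \<in> a" using bracket_skew[of x v] by simp
  ultimately show ?thesis
    using m(2) unfolding xv direct_sum_decomposition_def by blast
qed

end

context complex_lie_algebra
begin

lemma complex_span_real_ideal:
  assumes b: "real.ideal_of b UNIV"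
  shows "ideal_of {x + scale \<i> y | x y. x \<in> b \<and> y \<in> b} UNIV" (is "ideal_of ?c UNIV")
proof -
  have add: "x + y \<in> b" if "x \<in> b" "y \<in> b" for x y
    using real.subspace_add[OF real.ideal_subspace[OF b]] that .
  have smult: "scale (complex_of_real r) x \<in> b" if "x \<in> b" for r x
    using real.subspace_scale[OF real.ideal_subspace[OF b]] that .
  have br: "bracket z x \<in> b" if "x \<in> b" for x z
    using real.ideal_bracket[OF b] that by simp
  have zero: "0 \<in> b" using real.subspace_0[OF real.ideal_subspace[OF b]] .
  have "subspace ?c"
    unfolding subspace_def
  proof (intro conjI ballI allI)
    have "0 = 0 + scale \<i> 0" by simp
    then show "0 \<in> ?c" using zero by blast
  next
    fix u v assume "u \<in> ?c" "v \<in> ?c"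
    then obtain x y x' y' where h: "u = x + scale \<i> y" "v = x' + scale \<i> y'"
      "x \<in> b" "y \<in> b" "x' \<in> b" "y' \<in> b" by blast
    have "u + v = (x + x') + scale \<i> (y + y')" by (simp add: h scale_right_distrib)
    then show "u + v \<in> ?c" using h add by blast
  next
    fix k u assume "u \<in> ?c"
    then obtain x y where h: "u = x + scale \<i> y" "x \<in> b" "y \<in> b" by blast
    define r where "r = complex_of_real (Re k)"
    define s where "s = complex_of_real (Im k)"
    have k: "k = r + \<i> * s" unfolding r_def s_def by (rule complex_eq)
    have "k * \<i> = - s + \<i> * r" by (simp add: k algebra_simps)
    then have "scale k (scale \<i> y) = scale (- s) y + scale \<i> (scale r y)"
      by (simp only: scale_scale scale_left_distrib)
    moreover have "scale k x = scale r x + scale \<i> (scale s x)"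
      by (simp only: k scale_scale scale_left_distrib)
    ultimately have "scale k u = (scale r x + scale (- s) y) + scale \<i> (scale s x + scale r y)"
      unfolding h scale_right_distrib by (simp only: add_ac)
    moreover have "scale r x + scale (complex_of_real (- Im k)) y \<in> b" "scale s x + scale r y \<in> b"
      unfolding r_def s_def by (intro add smult h)+
    then have "scale r x + scale (- s) y \<in> b" "scale s x + scale r y \<in> b"
      by (simp_all add: s_def)
    ultimately show "scale k u \<in> ?c" by blast
  qed
  moreover have "bracket z u \<in> ?c" if u: "u \<in> ?c" for z u
  proof -
    obtain x y where h: "u = x + scale \<i> y" "x \<in> b" "y \<in> b" using u by blast
    have "bracket z u = bracket z x + scale \<i> (bracket z y)"
      by (simp add: h bracket_add_right bracket_scale_right)
    then show ?thesis using br h by blast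
  qed
  ultimately show ?thesis by (simp add: ideal_of_def)
qed

text \<open>
Reductivity speaks about complex ideals, so the real ideal \<open>b\<close> is replaced by \<open>b + \<i> b\<close>. This is commutative: the
brackets of \<open>b\<close> are central by hypothesis, hence zero.
\<close>

lemma reductive_real_ideal_central:
  assumes reductive and b: "real.ideal_of b UNIV"
    and cen: "\<And>x y z. x \<in> b \<Longrightarrow> y \<in> b \<Longrightarrow> bracket (bracket x y) z = 0" and x: "x \<in> b"
  shows "bracket x y = 0"
proof (rule reductive_abelian_ideal_central[OF assms(1) complex_span_real_ideal[OF b]])
  have ab: "bracket x y = 0" if "x \<in> b" "y \<in> b" for x y
    using reductive_center_commutator[OF assms(1)] cen[OF that] by (simp add: center_def)
  show "bracket u v = 0"
    if u: "u \<in> {x + scale \<i> y | x y. x \<in> b \<and> y \<in> b}" and v: "v \<in> {x + scale \<i> y | x y. x \<in> b \<and> y \<in> b}" for u v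
  proof -
    obtain x y where h: "u = x + scale \<i> y" "x \<in> b" "y \<in> b" using u by blast
    obtain x' y' where h': "v = x' + scale \<i> y'" "x' \<in> b" "y' \<in> b" using v by blast
    show ?thesis
      using ab h(2,3) h'(2,3)
      by (simp add: h(1) h'(1) bracket_add_left bracket_add_right bracket_scale_left bracket_scale_right)
  qed
  have "x = x + scale \<i> 0" by simp
  then show "x \<in> {x + scale \<i> y | x y. x \<in> b \<and> y \<in> b}"
    using x real.subspace_0[OF real.ideal_subspace[OF b]] by blast
qed

text \<open>
Used to count: the two isotropic subalgebras both have the complex dimension \<open>d\<close> of \<open>g\<close> as their real
dimension, so an orthogonal real basis has at most \<open>2 d\<close> elements, and the signature \<open>(d, d)\<close> leaves no room for
null vectors in it.
\<close>

lemma dim_le_sum_of_decomposition: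
  assumes E: "finite E" "real.span E = UNIV" and d: "direct_sum_decomposition U V"
  shows "real.dim UNIV \<le> real.dim U + real.dim V"
proof -
  obtain Bu where Bu: "Bu \<subseteq> U" "real.independent Bu" "U \<subseteq> real.span Bu" "card Bu = real.dim U"
    by (rule real.basis_exists)
  obtain Bv where Bv: "Bv \<subseteq> V" "real.independent Bv" "V \<subseteq> real.span Bv" "card Bv = real.dim V"
    by (rule real.basis_exists)
  have fin: "finite Bu" "finite Bv"
    using real.independent_span_bound[OF E(1) Bu(2)] real.independent_span_bound[OF E(1) Bv(2)] E(2)
    by simp_all
  have "x \<in> real.span (Bu \<union> Bv)" for x
  proof -
    obtain u v where "u \<in> U" "v \<in> V" "x = u + v"
      using d unfolding direct_sum_decomposition_def by blast
    moreover have "U \<subseteq> real.span (Bu \<union> Bv)" "V \<subseteq> real.span (Bu \<union> Bv)"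
      using Bu(3) Bv(3) real.span_mono[of Bu "Bu \<union> Bv"] real.span_mono[of Bv "Bu \<union> Bv"] by auto
    ultimately show ?thesis using real.span_add by blast
  qed
  then have "real.dim UNIV \<le> card (Bu \<union> Bv)"
    using fin by (intro real.dim_le_card) auto
  also have "\<dots> \<le> card Bu + card Bv" by (rule card_Un_le)
  finally show ?thesis by (simp add: Bu(4) Bv(4))
qed

text \<open>
An orthogonal basis without null vectors has its own rescaling as dual family.
\<close>

lemma orthogonal_expansion:
  assumes fin: "finite E" and span: "real.span E = UNIV" and sym: "symmetric_bilinear B"
    and orth: "\<And>e f. e \<in> E \<Longrightarrow> f \<in> E \<Longrightarrow> e \<noteq> f \<Longrightarrow> B e f = 0"
    and nz: "\<And>e. e \<in> E \<Longrightarrow> B e e \<noteq> 0"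
  shows "x = (\<Sum>e\<in>E. scale (complex_of_real (B x (scale (complex_of_real (1 / B e e)) e))) e)"
proof -
  have lin: "Vector_Spaces.linear (\<lambda>r. scale (complex_of_real r)) (*) (B x)" for x
    using sym by (simp add: symmetric_bilinear_def)
  have B_scale: "B x (scale (complex_of_real r) y) = r * B x y" for x y r
    using lin[of x] by (simp add: Vector_Spaces.linear_iff)
  have B_add: "B (x + y) z = B x z + B y z" for x y z
  proof -
    have "B z (x + y) = B z x + B z y" using lin[of z] by (simp add: Vector_Spaces.linear_iff)
    then show ?thesis using sym by (simp add: symmetric_bilinear_def)
  qed
  have B_scale': "B (scale (complex_of_real r) x) y = r * B x y" for x y r
    using B_scale[of y r x] sym by (simp add: symmetric_bilinear_def)
  define F where "F x = (\<Sum>e\<in>E. scale (complex_of_real (B x e / B e e)) e)" for x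
  have F_add: "F (x + y) = F x + F y" for x y
    by (simp add: F_def B_add add_divide_distrib scale_left_distrib sum.distrib)
  have F_scale: "F (scale (complex_of_real c) x) = scale (complex_of_real c) (F x)" for c x
    by (simp add: F_def B_scale' scale_sum_right)
  have "F 0 = 0" using F_scale[of 0 0] by simp
  then have "real.subspace {x. F x = x}"
    by (simp add: real.subspace_def F_add F_scale)
  moreover have "F e = e" if e: "e \<in> E" for e
  proof -
    have "F e = (\<Sum>f\<in>E. if f = e then e else 0)"
      unfolding F_def using orth nz e by (intro sum.cong) auto
    then show ?thesis using e fin by simp
  qed
  ultimately have "real.span E \<subseteq> {x. F x = x}" by (intro real.span_minimal) auto
  then have Fx: "F x = x" using span by blast
  have "F x = (\<Sum>e\<in>E. scale (complex_of_real (B x (scale (complex_of_real (1 / B e e)) e))) e)"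
    unfolding F_def B_scale by simp
  from this[unfolded Fx] show ?thesis .
qed

end

theorem theorem2:
  fixes scale :: "complex \<Rightarrow> 'g::ab_group_add \<Rightarrow> 'g"
    and bracket :: "'g \<Rightarrow> 'g \<Rightarrow> 'g"
    and j0 b0 b0' p p' :: "'g set"
  assumes "complex_lie_algebra scale bracket"
    and "lie_algebra.reductive scale bracket"
    and "\<not> lie_algebra.commutative bracket"
    and "lie_algebra.cartan_subalgebra scale bracket j0"
    and "lie_algebra.borel_subalgebra scale bracket b0"
    and "j0 \<subseteq> b0"
    and "b0' = lie_algebra.opposite_borel scale bracket j0 b0"
    and "lie_algebra.parabolic_subalgebra scale bracket p"
    and "lie_algebra.parabolic_subalgebra scale bracket p'"
    and "b0 \<subseteq> p"
    and "b0' \<subseteq> p'"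
    and "\<exists>B i i'. complex_lie_algebra.manin_triple_under scale bracket B i i' p p'"
  shows "p \<noteq> UNIV \<or> p' \<noteq> UNIV"
proof (rule ccontr)
  assume "\<not> (p \<noteq> UNIV \<or> p' \<noteq> UNIV)"
  then have p: "p = UNIV" "p' = UNIV" by simp_all
  interpret complex_lie_algebra scale bracket by (fact assms(1))
  obtain B i i' where "manin_triple_under B i i' p p'" using assms(12) by blast
  then have triple: "manin_triple B i i'" and under: "under B i UNIV" "under B i' UNIV"
    by (simp_all add: manin_triple_under_def p)
  then have sym: "symmetric_bilinear B" and inv: "invariant B"
    and sig: "has_signature B (dim UNIV) (dim UNIV)"
    and sub: "real.subalgebra i" "real.subalgebra i'" and iso: "isotropic B i" "isotropic B i'"
    and dec: "direct_sum_decomposition i i'"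
    by (simp_all add: manin_triple_def manin_form_def)
  obtain n where n: "real.is_nilpotent_radical n i" "UNIV = normalizer n"
    using under(1) unfolding under_def by blast
  obtain n' where n': "real.is_nilpotent_radical n' i'" "UNIV = normalizer n'"
    using under(2) unfolding under_def by blast
  have norm: "bracket x y \<in> n" if "y \<in> n" for x y
  proof -
    have "x \<in> normalizer n" using n(2) by blast
    then show ?thesis using that by (simp add: normalizer_def)
  qed
  have norm': "bracket x y \<in> n'" if "y \<in> n'" for x y
  proof -
    have "x \<in> normalizer n'" using n'(2) by blast
    then show ?thesis using that by (simp add: normalizer_def)
  qed
  obtain E where E: "finite E" "real.independent E" "real.span E = UNIV"
    and orth: "\<forall>e\<in>E. \<forall>f\<in>E. e \<noteq> f \<longrightarrow> B e f = 0"
    and pos: "card {e\<in>E. B e e > 0} = dim UNIV" and neg: "card {e\<in>E. B e e < 0} = dim UNIV"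
    using sig unfolding has_signature_def by (elim exE conjE) (rule that)
  \<comment> \<open>the vectors of positive and negative square are already as many as the dimension allows\<close>
  have nz: "B e e \<noteq> 0" if "e \<in> E" for e
  proof -
    have "card E = real.dim UNIV"
      using real.dim_span_eq_card_independent[OF E(2)] by (simp add: E(3))
    also have "\<dots> \<le> real.dim i + real.dim i'" by (rule dim_le_sum_of_decomposition[OF E(1,3) dec])
    also have "\<dots> = card {e\<in>E. B e e > 0} + card {e\<in>E. B e e < 0}"
      using under by (simp add: under_def pos neg)
    also have "\<dots> = card ({e\<in>E. B e e > 0} \<union> {e\<in>E. B e e < 0})"
      using E(1) by (intro card_Un_disjoint[symmetric]) auto
    finally have "{e\<in>E. B e e > 0} \<union> {e\<in>E. B e e < 0} = E"
      using E(1) by (intro card_seteq) auto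
    then have "e \<in> {e\<in>E. B e e > 0} \<union> {e\<in>E. B e e < 0}" using that by simp
    then show ?thesis by auto
  qed
  have lin: "Vector_Spaces.linear (\<lambda>r. scale (complex_of_real r)) (*) (B x)" for x
    using sym by (simp add: symmetric_bilinear_def)
  have B_sym: "B x y = B y x" for x y using sym by (simp add: symmetric_bilinear_def)
  interpret lagrangian_splitting "\<lambda>r. scale (complex_of_real r)" bracket B E
    "\<lambda>e. scale (complex_of_real (1 / B e e)) e" i i'
  proof unfold_locales
    show "B (x + y) z = B x z + B y z" for x y z
      unfolding B_sym[of _ z] using lin[of z] by (simp add: Vector_Spaces.linear_iff)
    show "B (scale (complex_of_real c) x) y = c * B x y" for c x y
      unfolding B_sym[of _ y] using lin[of y] by (simp add: Vector_Spaces.linear_iff)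
    show "B x y = B y x" for x y by (rule B_sym)
    show "B (bracket x y) z = - B y (bracket x z)" for x y z
      using inv unfolding invariant_def by (simp add: eq_neg_iff_add_eq_0)
    show "finite E" by (rule E(1))
    show "x = (\<Sum>e\<in>E. scale (complex_of_real (B x (scale (complex_of_real (1 / B e e)) e))) e)" for x
    proof (rule orthogonal_expansion[OF E(1,3) sym])
      show "B e f = 0" if "e \<in> E" "f \<in> E" "e \<noteq> f" for e f using orth that by blast
    qed (rule nz)
    show "B x y = 0" if "x \<in> i" "y \<in> i" for x y using iso(1) that by (simp add: isotropic_def)
    show "B x y = 0" if "x \<in> i'" "y \<in> i'" for x y using iso(2) that by (simp add: isotropic_def)
  qed (fact sub dec)+
  have "bracket x y = 0" for x y
  proof (rule commutative_if_radicals_normalized[OF _ n(1) _ n'(1)])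
    show two_step_ideals_central
      unfolding two_step_ideals_central_def
    proof (intro allI impI ballI)
      fix b x y assume "real.ideal_of b UNIV" "\<forall>x\<in>b. \<forall>y\<in>b. \<forall>z. bracket (bracket x y) z = 0" "x \<in> b"
      then show "bracket x y = 0"
        using reductive_real_ideal_central[OF assms(2), of b x y] by simp
    qed
    show "bracket x y \<in> n" if "y \<in> n" for x y using that by (rule norm)
    show "bracket x y \<in> n'" if "y \<in> n'" for x y using that by (rule norm')
  qed
  then show False using assms(3) by (simp add: commutative_def)
qed

end
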